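(* Let $W$ be a Weyl tensor of type IM$^+$, with eigenvalues $\rho_1,\rho_2,\rho_3$ and orthonormal frame $\{\mathcal U_i\}$ of self-dual eigenbivectors, so that $\mathcal W=-\sum_{i}\rho_i\,\mathcal U_i\otimes\mathcal U_i$. Then its Bel-Robinson tensor $T$ admits the canonical expression $$T=\sum_{i=1}^3t_i\,\Pi_i\otimes\Pi_i+\sum_{(ijk)}\tau_i\,(\Pi_{jk}\otimes\Pi_{jk}+\Pi_{kj}\otimes\Pi_{kj}),$$ where $\sum_{(ijk)}$ runs over the even permutations of $(1,2,3)$, $t_i=|\rho_i|^2$, $\tau_i=\rho_j\overline\rho_k$, $\Pi_i=\mathcal U_i\cdot\overline{\mathcal U}_i$, $\Pi_{jk}=\mathcal U_j\cdot\overline{\mathcal U}_k$. The eigenvalues $t_i$ of $T$ are simple and are associated with the eigentensors $\Pi_i$, and the eigenvalues $\tau_i$ are real, double, and are associated with the eigenplanes $S_i=\langle\Pi_{jk},\Pi_{kj}\rangle$, $(i,j,k)$ being an even permutation of $(1,2,3)$.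
   Context: $(V,g)$ is an oriented 4-dimensional real vector space with a Lorentzian metric of signature $(-,+,+,+)$ (the tangent space of a space-time at a point); indices are moved with $g$; $\eta$ is the metric volume element; $( *F)_{\alpha\beta}=\frac12\eta_{\alpha\beta\mu\nu}F^{\mu\nu}$, $( *W)_{\alpha\beta\mu\nu}=\frac12\eta_{\alpha\beta}{}^{\rho\sigma}W_{\rho\sigma\mu\nu}$. A self-dual (SD) bivector is a complex 2-form $\mathcal F$ with $*\mathcal F=\mathrm i\mathcal F$; these form a complex 3-dimensional space with metric $\mathcal G(\mathcal F,\mathcal H)=\frac12\mathcal F_{\alpha\beta}\mathcal H^{\alpha\beta}$. A frame $\{\mathcal U_i\}$ of SD bivectors is orthonormal if $\mathcal G(\mathcal U_i,\mathcal U_j)=-\delta_{ij}$. A Weyl tensor $W$ is a real 4-tensor with the algebraic symmetries of a Riemann tensor and vanishing traces; $\mathcal W=\frac12(W-\mathrm i*W)$ acts on SD bivectors by $\mathcal W(\mathcal F)_{\alpha\beta}=\frac12\mathcal W_{\alpha\beta}{}^{\mu\nu}\mathcal F_{\mu\nu}$, with eigenvalues $\rho_i$, $\sum\rho_i=0$. Put $a=\operatorname{Tr}\mathcal W^2=\sum\rho_i^2$, $b=\operatorname{Tr}\mathcal W^3=\sum\rho_i^3$, $M=a^3/b^2-6$. $W$ is of type I if the $\rho_i$ are distinct (equivalently $6b^2\neq a^3$), and of type IM$^+$ if it is of type I, $b\neq0$ and $M$ is a positive real number. The Bel-Robinson (BR) tensor of $W$ is $T_{\alpha\mu\beta\nu}=\mathcal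 W_{\alpha}{}^{\rho}{}_{\beta}{}^{\sigma}\,\overline{\mathcal W}_{\mu\rho\nu\sigma}$; it is totally symmetric and traceless and acts on the (complexified) 9-dimensional space of traceless symmetric 2-tensors by $T(A)_{\alpha\beta}=T_{\alpha\beta}{}^{\mu\nu}A_{\mu\nu}$; an eigentensor is an eigenvector of this map. For 2-tensors $(A\cdot B)_{\alpha\beta}=A_{\alpha}{}^{\mu}B_{\mu\beta}$. $\langle\cdot\rangle$ denotes (complex) linear span. *)

theory Defs
  imports "HOL-Analysis.Analysis" "HOL-Library.Function_Algebras"
begin

text \<open>
  Tensors over the 4-dimensional space are given by their covariant components in an arbitrary
  basis indexed by the type \<^typ>\<open>4\<close>; the metric is its Gram matrix in that basis, so it need not
  be diagonal. All index raising is done explicitly with the inverse matrix.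
\<close>

type_synonym metric = "real^4^4"
type_synonym 'a tensor2 = "4 \<Rightarrow> 4 \<Rightarrow> 'a"
type_synonym 'a tensor4 = "4 \<Rightarrow> 4 \<Rightarrow> 4 \<Rightarrow> 4 \<Rightarrow> 'a"


subsection \<open>Complex 2-tensors as a complex vector space\<close>

definition scale2 :: "complex \<Rightarrow> complex tensor2 \<Rightarrow> complex tensor2" where
  "scale2 c A = (\<lambda>\<alpha> \<beta>. c * A \<alpha> \<beta>)"

global_interpretation tensor2: vector_space scale2
  by unfold_locales (auto simp: scale2_def fun_eq_iff algebra_simps)


subsection \<open>Oriented Lorentzian metric\<close>

definition minkowski :: metric where
  "minkowski = (\<chi> \<alpha> \<beta>. if \<alpha> = \<beta> then (if \<alpha> = 0 then -1 else 1) else 0)"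

text \<open>Signature \<open>(-,+,+,+)\<close>: the columns of \<open>P\<close> form an orthonormal basis.\<close>

definition lorentzian :: "metric \<Rightarrow> bool" where
  "lorentzian g \<longleftrightarrow> (\<exists>P. invertible P \<and> transpose P ** g ** P = minkowski)"

definition raise2 :: "metric \<Rightarrow> complex tensor2 \<Rightarrow> complex tensor2" where
  "raise2 g F = (\<lambda>\<mu> \<nu>. \<Sum>\<rho>\<in>UNIV. \<Sum>\<sigma>\<in>UNIV.
      complex_of_real (matrix_inv g $ \<mu> $ \<rho> * matrix_inv g $ \<nu> $ \<sigma>) * F \<rho> \<sigma>)"

text \<open>
  A metric volume element is a real 4-form with \<open>\<eta>\<^sub>\<alpha>\<^sub>\<beta>\<^sub>\<mu>\<^sub>\<nu> \<eta>\<^sup>\<alpha>\<^sup>\<beta>\<^sup>\<mu>\<^sup>\<nu> = -24\<close>. For a Lorentzian metric there are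
  exactly two of them, one for each orientation; choosing \<open>\<eta>\<close> is choosing the orientation
  (together with the sign convention for \<open>\<eta>\<close> on positively oriented orthonormal bases).
\<close>

definition volume_element :: "metric \<Rightarrow> real tensor4 \<Rightarrow> bool" where
  "volume_element g \<eta> \<longleftrightarrow>
     (\<forall>\<alpha> \<beta> \<mu> \<nu>. \<eta> \<alpha> \<beta> \<mu> \<nu> = - \<eta> \<beta> \<alpha> \<mu> \<nu> \<and> \<eta> \<alpha> \<beta> \<mu> \<nu> = - \<eta> \<alpha> \<mu> \<beta> \<nu> \<and> \<eta> \<alpha> \<beta> \<mu> \<nu> = - \<eta> \<alpha> \<beta> \<nu> \<mu>) \<and>
     (\<Sum>\<alpha>\<in>UNIV. \<Sum>\<beta>\<in>UNIV. \<Sum>\<mu>\<in>UNIV. \<Sum>\<nu>\<in>UNIV.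
      \<Sum>\<alpha>'\<in>UNIV. \<Sum>\<beta>'\<in>UNIV. \<Sum>\<mu>'\<in>UNIV. \<Sum>\<nu>'\<in>UNIV.
        matrix_inv g $ \<alpha> $ \<alpha>' * matrix_inv g $ \<beta> $ \<beta>' * matrix_inv g $ \<mu> $ \<mu>' * matrix_inv g $ \<nu> $ \<nu>'
        * \<eta> \<alpha> \<beta> \<mu> \<nu> * \<eta> \<alpha>' \<beta>' \<mu>' \<nu>') = -24"


subsection \<open>Self-dual bivectors\<close>

text \<open>Action \<open>(X F)\<^sub>\<alpha>\<^sub>\<beta> = \<onehalf> X\<^sub>\<alpha>\<^sub>\<beta>\<^sup>\<mu>\<^sup>\<nu> F\<^sub>\<mu>\<^sub>\<nu>\<close> of a double 2-form on a 2-form.\<close>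

definition biv_act :: "metric \<Rightarrow> complex tensor4 \<Rightarrow> complex tensor2 \<Rightarrow> complex tensor2" where
  "biv_act g X F = (\<lambda>\<alpha> \<beta>. (1/2) * (\<Sum>\<mu>\<in>UNIV. \<Sum>\<nu>\<in>UNIV. X \<alpha> \<beta> \<mu> \<nu> * raise2 g F \<mu> \<nu>))"

definition hodge :: "metric \<Rightarrow> real tensor4 \<Rightarrow> complex tensor2 \<Rightarrow> complex tensor2" where
  "hodge g \<eta> F = (\<lambda>\<alpha> \<beta>. (1/2) * (\<Sum>\<mu>\<in>UNIV. \<Sum>\<nu>\<in>UNIV. complex_of_real (\<eta> \<alpha> \<beta> \<mu> \<nu>) * raise2 g F \<mu> \<nu>))"

definition SD :: "metric \<Rightarrow> real tensor4 \<Rightarrow> complex tensor2 set" where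
  "SD g \<eta> = {F. (\<forall>\<alpha> \<beta>. F \<alpha> \<beta> = - F \<beta> \<alpha>) \<and> hodge g \<eta> F = scale2 \<i> F}"

definition biv_metric :: "metric \<Rightarrow> complex tensor2 \<Rightarrow> complex tensor2 \<Rightarrow> complex" where
  "biv_metric g F H = (1/2) * (\<Sum>\<alpha>\<in>UNIV. \<Sum>\<beta>\<in>UNIV. F \<alpha> \<beta> * raise2 g H \<alpha> \<beta>)"

text \<open>
  A frame is a basis of the space of SD bivectors; linear independence of the family follows from
  the orthonormality relations. The index type \<^typ>\<open>3\<close> has the elements 1, 2, 3 with 3 = 0.
\<close>

definition SD_orthonormal_frame :: "metric \<Rightarrow> real tensor4 \<Rightarrow> (3 \<Rightarrow> complex tensor2) \<Rightarrow> bool" where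
  "SD_orthonormal_frame g \<eta> U \<longleftrightarrow>
     tensor2.span (range U) = SD g \<eta> \<and>
     (\<forall>i j. biv_metric g (U i) (U j) = (if i = j then -1 else 0))"


subsection \<open>Weyl tensors\<close>

definition weyl_tensor :: "metric \<Rightarrow> real tensor4 \<Rightarrow> bool" where
  "weyl_tensor g W \<longleftrightarrow>
     (\<forall>\<alpha> \<beta> \<mu> \<nu>. W \<alpha> \<beta> \<mu> \<nu> = - W \<beta> \<alpha> \<mu> \<nu> \<and> W \<alpha> \<beta> \<mu> \<nu> = - W \<alpha> \<beta> \<nu> \<mu> \<and> W \<alpha> \<beta> \<mu> \<nu> = W \<mu> \<nu> \<alpha> \<beta> \<and>
        W \<alpha> \<beta> \<mu> \<nu> + W \<alpha> \<mu> \<nu> \<beta> + W \<alpha> \<nu> \<beta> \<mu> = 0) \<and>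
     (\<forall>\<beta> \<nu>. (\<Sum>\<alpha>\<in>UNIV. \<Sum>\<mu>\<in>UNIV. matrix_inv g $ \<alpha> $ \<mu> * W \<alpha> \<beta> \<mu> \<nu>) = 0)"

text \<open>\<open>\<W> = \<onehalf>(W - i *W)\<close>, the dual being taken on the first pair of indices.\<close>

definition sd_weyl :: "metric \<Rightarrow> real tensor4 \<Rightarrow> real tensor4 \<Rightarrow> complex tensor4" where
  "sd_weyl g \<eta> W = (\<lambda>\<alpha> \<beta> \<mu> \<nu>.
     (complex_of_real (W \<alpha> \<beta> \<mu> \<nu>)
       - \<i> * hodge g \<eta> (\<lambda>\<rho> \<sigma>. complex_of_real (W \<rho> \<sigma> \<mu> \<nu>)) \<alpha> \<beta>) / 2)"

text \<open>Composition and trace of double 2-forms as endomorphisms \<open>biv_act\<close> of the space of 2-forms.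
  Since \<open>\<W>\<close> vanishes on anti-self-dual bivectors, the traces of its powers on all 2-forms and on
  SD bivectors coincide.\<close>

definition biv_comp :: "metric \<Rightarrow> complex tensor4 \<Rightarrow> complex tensor4 \<Rightarrow> complex tensor4" where
  "biv_comp g X Y = (\<lambda>\<alpha> \<beta> \<mu> \<nu>. biv_act g X (\<lambda>\<rho> \<sigma>. Y \<rho> \<sigma> \<mu> \<nu>) \<alpha> \<beta>)"

definition biv_trace :: "metric \<Rightarrow> complex tensor4 \<Rightarrow> complex" where
  "biv_trace g X = (1/2) * (\<Sum>\<alpha>\<in>UNIV. \<Sum>\<beta>\<in>UNIV. raise2 g (X \<alpha> \<beta>) \<alpha> \<beta>)"

definition weyl_a :: "metric \<Rightarrow> real tensor4 \<Rightarrow> real tensor4 \<Rightarrow> complex" where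
  "weyl_a g \<eta> W = (let X = sd_weyl g \<eta> W in biv_trace g (biv_comp g X X))"

definition weyl_b :: "metric \<Rightarrow> real tensor4 \<Rightarrow> real tensor4 \<Rightarrow> complex" where
  "weyl_b g \<eta> W = (let X = sd_weyl g \<eta> W in biv_trace g (biv_comp g X (biv_comp g X X)))"

definition weyl_M :: "metric \<Rightarrow> real tensor4 \<Rightarrow> real tensor4 \<Rightarrow> complex" where
  "weyl_M g \<eta> W = weyl_a g \<eta> W ^ 3 / weyl_b g \<eta> W ^ 2 - 6"

definition weyl_eigenvalues :: "metric \<Rightarrow> real tensor4 \<Rightarrow> real tensor4 \<Rightarrow> complex set" where
  "weyl_eigenvalues g \<eta> W =
     {r. \<exists>F \<in> SD g \<eta>. F \<noteq> 0 \<and> biv_act g (sd_weyl g \<eta> W) F = scale2 r F}"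

text \<open>SD bivectors have complex dimension 3, so the three eigenvalues counted with multiplicity
  are distinct iff there are three of them.\<close>

definition type_I :: "metric \<Rightarrow> real tensor4 \<Rightarrow> real tensor4 \<Rightarrow> bool" where
  "type_I g \<eta> W \<longleftrightarrow> card (weyl_eigenvalues g \<eta> W) = 3"

definition type_IMplus :: "metric \<Rightarrow> real tensor4 \<Rightarrow> real tensor4 \<Rightarrow> bool" where
  "type_IMplus g \<eta> W \<longleftrightarrow>
     type_I g \<eta> W \<and> weyl_b g \<eta> W \<noteq> 0 \<and> (\<exists>m::real. m > 0 \<and> weyl_M g \<eta> W = complex_of_real m)"


subsection \<open>Bel-Robinson tensor and its spectral data\<close>

definition bel_robinson :: "metric \<Rightarrow> real tensor4 \<Rightarrow> real tensor4 \<Rightarrow> complex tensor4" where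
  "bel_robinson g \<eta> W = (\<lambda>\<alpha> \<mu> \<beta> \<nu>. \<Sum>\<rho>\<in>UNIV. \<Sum>\<sigma>\<in>UNIV.
     raise2 g (\<lambda>\<rho>' \<sigma>'. sd_weyl g \<eta> W \<alpha> \<rho>' \<beta> \<sigma>') \<rho> \<sigma> * cnj (sd_weyl g \<eta> W \<mu> \<rho> \<nu> \<sigma>))"

definition sym_traceless :: "metric \<Rightarrow> complex tensor2 set" where
  "sym_traceless g = {A. (\<forall>\<alpha> \<beta>. A \<alpha> \<beta> = A \<beta> \<alpha>) \<and>
     (\<Sum>\<alpha>\<in>UNIV. \<Sum>\<beta>\<in>UNIV. complex_of_real (matrix_inv g $ \<alpha> $ \<beta>) * A \<alpha> \<beta>) = 0}"

definition tensor_act :: "metric \<Rightarrow> complex tensor4 \<Rightarrow> complex tensor2 \<Rightarrow> complex tensor2" where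
  "tensor_act g T A = (\<lambda>\<alpha> \<beta>. \<Sum>\<mu>\<in>UNIV. \<Sum>\<nu>\<in>UNIV. T \<alpha> \<beta> \<mu> \<nu> * raise2 g A \<mu> \<nu>)"

definition eigenspace :: "metric \<Rightarrow> complex tensor4 \<Rightarrow> complex \<Rightarrow> complex tensor2 set" where
  "eigenspace g T l = {A \<in> sym_traceless g. tensor_act g T A = scale2 l A}"

text \<open>Algebraic multiplicity: the dimension of the generalized eigenspace.\<close>

definition eigen_mult :: "metric \<Rightarrow> complex tensor4 \<Rightarrow> complex \<Rightarrow> nat" where
  "eigen_mult g T l =
     tensor2.dim {A \<in> sym_traceless g. \<exists>n. ((\<lambda>B. tensor_act g T B - scale2 l B) ^^ n) A = 0}"

definition dot2 :: "metric \<Rightarrow> complex tensor2 \<Rightarrow> complex tensor2 \<Rightarrow> complex tensor2" where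
  "dot2 g A B = (\<lambda>\<alpha> \<beta>. \<Sum>\<mu>\<in>UNIV. \<Sum>\<nu>\<in>UNIV.
     A \<alpha> \<nu> * complex_of_real (matrix_inv g $ \<nu> $ \<mu>) * B \<mu> \<beta>)"

definition otimes2 :: "complex tensor2 \<Rightarrow> complex tensor2 \<Rightarrow> complex tensor4" where
  "otimes2 A B = (\<lambda>\<alpha> \<beta> \<mu> \<nu>. A \<alpha> \<beta> * B \<mu> \<nu>)"

text \<open>\<open>\<Pi>\<^sub>j\<^sub>k = \<U>\<^sub>j \<cdot> cnj \<U>\<^sub>k\<close>; the tensor \<open>\<Pi>\<^sub>i\<close> is \<open>\<Pi>\<^sub>i\<^sub>i\<close>.\<close>

definition frame_prod :: "metric \<Rightarrow> (3 \<Rightarrow> complex tensor2) \<Rightarrow> 3 \<Rightarrow> 3 \<Rightarrow> complex tensor2" where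
  "frame_prod g U j k = dot2 g (U j) (\<lambda>\<alpha> \<beta>. cnj (U k \<alpha> \<beta>))"

text \<open>The even permutations of (1,2,3) are the triples \<open>(i, i+1, i+2)\<close> with \<open>i :: 3\<close> (addition is
  modulo 3), so \<open>t\<^sub>i\<close> and \<open>\<tau>\<^sub>i\<close> both depend on \<open>i\<close> alone.\<close>

definition br_t :: "(3 \<Rightarrow> complex) \<Rightarrow> 3 \<Rightarrow> complex" where
  "br_t \<rho> i = complex_of_real ((cmod (\<rho> i))\<^sup>2)"

definition br_tau :: "(3 \<Rightarrow> complex) \<Rightarrow> 3 \<Rightarrow> complex" where
  "br_tau \<rho> i = \<rho> (i+1) * cnj (\<rho> (i+2))"

definition br_plane :: "metric \<Rightarrow> (3 \<Rightarrow> complex tensor2) \<Rightarrow> 3 \<Rightarrow> complex tensor2 set" where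
  "br_plane g U i = tensor2.span {frame_prod g U (i+1) (i+2), frame_prod g U (i+2) (i+1)}"

end

theory Submission
  imports Defs
begin

text \<open>
  The three SD eigenbivectors give nine products \<open>\<Pi>\<^sub>i\<^sub>j\<close>. Since
  \<open>(F \<cdot> cnj K)\<^sub>\<alpha>\<^sub>\<beta> (H \<cdot> cnj L)\<^sup>\<alpha>\<^sup>\<beta> = \<G>(F,H) cnj \<G>(K,L)\<close> for SD bivectors, they form an orthonormal basis of
  the traceless symmetric tensors, and inserting \<open>\<W> = -\<Sum> \<rho>\<^sub>i \<U>\<^sub>i \<otimes> \<U>\<^sub>i\<close> into the definition of \<open>T\<close> gives
  \<open>T = \<Sum> \<rho>\<^sub>i cnj \<rho>\<^sub>j \<Pi>\<^sub>i\<^sub>j \<otimes> \<Pi>\<^sub>i\<^sub>j\<close>, so \<open>T\<close> is diagonal in this basis.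

  The numbers \<open>y\<^sub>i = \<rho>\<^sub>i a / b\<close> are the roots of \<open>y\<^sup>3 - (m/2) y - m/3\<close> with \<open>m = M + 6\<close>, whose discriminant is
  \<open>m\<^sup>2 M / 2\<close>. For \<open>M > 0\<close> they are real, distinct and nonzero; together with \<open>\<Sum> y\<^sub>i = 0\<close> this makes the
  products \<open>y\<^sub>j y\<^sub>k\<close>, \<open>j \<le> k\<close>, pairwise distinct, and \<open>\<rho>\<^sub>j cnj \<rho>\<^sub>k\<close> is a fixed positive multiple of \<open>y\<^sub>j y\<^sub>k\<close>.

  The metric facts about SD bivectors and Weyl tensors are checked in components in an orthonormal tetrad.
\<close>

section \<open>Orthonormal tetrads and change of basis\<close>

lemma UNIV_4_from_0: "(UNIV::4 set) = {0,1,2,3}"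
proof -
  \<comment> \<open>Arithmetic in type \<open>4\<close> is modulo 4, so the element usually written
    4 is the time index 0 of \<open>minkowski\<close>.\<close>
  have "(4::4) = 0" by simp
  then show ?thesis using UNIV_4 by (metis insert_commute)
qed

lemma sum_4_from_0: "sum f (UNIV::4 set) = f 0 + f 1 + f 2 + f 3"
  unfolding UNIV_4_from_0 by (simp add: ac_simps)

lemma forall_4_from_0: "(\<forall>i::4. P i) \<longleftrightarrow> P 0 \<and> P 1 \<and> P 2 \<and> P 3"
  by (metis UNIV_4_from_0 UNIV_I insertE singletonD)

lemma matrix_inv_unique:
  fixes A B :: "'a::semiring_1^'n^'n"
  assumes "A ** B = mat 1" "B ** A = mat 1"
  shows "matrix_inv A = B"
proof -
  have "A ** matrix_inv A = mat 1 \<and> matrix_inv A ** A = mat 1"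
    unfolding matrix_inv_def by (rule someI[of _ B]) (simp add: assms)
  then show ?thesis
    by (metis assms(1) matrix_mul_assoc matrix_mul_lid matrix_mul_rid)
qed

lemma minkowski_sq: "minkowski ** minkowski = mat 1"
  by (simp add: minkowski_def matrix_matrix_mult_def mat_def vec_eq_iff forall_4_from_0 sum_4_from_0)

lemma matrix_inv_minkowski: "matrix_inv minkowski = minkowski"
  by (rule matrix_inv_unique) (simp_all add: minkowski_sq)

text \<open>As \<open>minkowski\<close> squares to 1, P^T g P = \<open>minkowski\<close> exhibits a
  right inverse of P^T g. Right inverses of square matrices are left inverses, and using this twice
  inverts \<open>g\<close>. \<open>Q\<close> is kept because pulling back along it undoes pulling
  back along \<open>P\<close>.\<close>

lemma lorentzian_tetrad:
  assumes "lorentzian g"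
  obtains P Q where "P ** Q = mat 1" "Q ** P = mat 1"
    "matrix_inv g = P ** minkowski ** transpose P"
proof -
  obtain P where P: "invertible P" "transpose P ** g ** P = minkowski"
    using assms lorentzian_def by blast
  obtain Q where Q: "P ** Q = mat 1" "Q ** P = mat 1"
    using P(1) invertible_def by blast
  have "transpose P ** g ** (P ** minkowski) = mat 1"
    using P(2) by (simp add: matrix_mul_assoc minkowski_sq)
  then have "P ** minkowski ** (transpose P ** g) = mat 1"
    using matrix_left_right_inverse by blast
  then have 1: "P ** minkowski ** transpose P ** g = mat 1"
    by (simp add: matrix_mul_assoc)
  then have 2: "g ** (P ** minkowski ** transpose P) = mat 1"
    using matrix_left_right_inverse by blast
  show thesis using that[OF Q] matrix_inv_unique[OF 2 1] by blast
qed

text \<open>The Minkowski matrix is its own inverse, so its diagonal signs also raise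
  indices.\<close>

definition lsign :: "4 \<Rightarrow> real" where
  "lsign a = (if a = 0 then -1 else 1)"

lemma minkowski_nth: "minkowski $ a $ b = (if a = b then lsign a else 0)"
  by (simp add: minkowski_def lsign_def)

lemma sum_swap3:
  "(\<Sum>\<rho>\<in>A. \<Sum>\<sigma>\<in>B. \<Sum>a\<in>C. f \<rho> \<sigma> a) = (\<Sum>a\<in>C. \<Sum>\<sigma>\<in>B. \<Sum>\<rho>\<in>A. f \<rho> \<sigma> a)"
proof -
  have "(\<Sum>\<rho>\<in>A. \<Sum>\<sigma>\<in>B. \<Sum>a\<in>C. f \<rho> \<sigma> a) = (\<Sum>\<sigma>\<in>B. \<Sum>\<rho>\<in>A. \<Sum>a\<in>C. f \<rho> \<sigma> a)"
    by (rule sum.swap)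
  also have "\<dots> = (\<Sum>\<sigma>\<in>B. \<Sum>a\<in>C. \<Sum>\<rho>\<in>A. f \<rho> \<sigma> a)"
    by (rule sum.cong[OF refl], rule sum.swap)
  also have "\<dots> = (\<Sum>a\<in>C. \<Sum>\<sigma>\<in>B. \<Sum>\<rho>\<in>A. f \<rho> \<sigma> a)"
    by (rule sum.swap)
  finally show ?thesis .
qed

lemma sum_swap4:
  "(\<Sum>\<rho>\<in>A. \<Sum>\<sigma>\<in>B. \<Sum>a\<in>C. \<Sum>b\<in>D. f \<rho> \<sigma> a b) = (\<Sum>a\<in>C. \<Sum>b\<in>D. \<Sum>\<rho>\<in>A. \<Sum>\<sigma>\<in>B. f \<rho> \<sigma> a b)"
  by (rule trans[OF sum_swap3], rule sum.cong[OF refl], rule sum_swap3)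

lemma sum_delta2:
  fixes a :: "'a::finite" and b :: "'b::finite" and f :: "'a \<Rightarrow> 'b \<Rightarrow> 'c::comm_monoid_add"
  shows "(\<Sum>\<alpha>\<in>UNIV. \<Sum>\<beta>\<in>UNIV. if \<alpha> = a \<and> \<beta> = b then f \<alpha> \<beta> else 0) = f a b"
proof -
  have "(\<Sum>\<beta>\<in>UNIV. if \<alpha> = a \<and> \<beta> = b then f \<alpha> \<beta> else 0) = (if \<alpha> = a then f \<alpha> b else 0)" for \<alpha>
    by simp
  then show ?thesis by simp
qed

section \<open>Components of covariant tensors in a new basis\<close>

definition pull2 :: "real^4^4 \<Rightarrow> (4 \<Rightarrow> 4 \<Rightarrow> 'a::real_field) \<Rightarrow> 4 \<Rightarrow> 4 \<Rightarrow> 'a" where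
  "pull2 P F a b = (\<Sum>\<alpha>\<in>UNIV. \<Sum>\<beta>\<in>UNIV. of_real (P $ \<alpha> $ a * P $ \<beta> $ b) * F \<alpha> \<beta>)"

text \<open>The columns of \<open>P\<close> are the new basis vectors. Nesting \<open>pull2\<close>
  lets its linearity facts act on one index pair while the other is a parameter; the field is
  generic because real and complex tensors are both transformed.\<close>

definition pull4 :: "real^4^4 \<Rightarrow> (4 \<Rightarrow> 4 \<Rightarrow> 4 \<Rightarrow> 4 \<Rightarrow> 'a::real_field) \<Rightarrow> 4 \<Rightarrow> 4 \<Rightarrow> 4 \<Rightarrow> 4 \<Rightarrow> 'a" where
  "pull4 P X a b = pull2 P (\<lambda>\<mu> \<nu>. pull2 P (\<lambda>\<alpha> \<beta>. X \<alpha> \<beta> \<mu> \<nu>) a b)"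

lemma pull2_sum: "pull2 P (\<lambda>\<alpha> \<beta>. \<Sum>i\<in>I. F i \<alpha> \<beta>) a b = (\<Sum>i\<in>I. pull2 P (F i) a b)"
  unfolding pull2_def sum_distrib_left
  by (subst sum.swap[of _ I], subst sum.swap[of _ I]) (rule refl)

lemma pull2_mult: "pull2 P (\<lambda>\<alpha> \<beta>. c * F \<alpha> \<beta>) a b = c * pull2 P F a b"
  unfolding pull2_def by (simp add: sum_distrib_left ac_simps)

lemma pull2_mult_right: "pull2 P (\<lambda>\<alpha> \<beta>. F \<alpha> \<beta> * c) a b = pull2 P F a b * c"
  using pull2_mult[of P c F] by (simp add: mult.commute)

lemma pull2_diff: "pull2 P (\<lambda>\<alpha> \<beta>. F \<alpha> \<beta> - H \<alpha> \<beta>) a b = pull2 P F a b - pull2 P H a b"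
  unfolding pull2_def by (simp add: sum_subtractf algebra_simps)

lemma pull2_minus: "pull2 P (\<lambda>\<alpha> \<beta>. - F \<alpha> \<beta>) a b = - pull2 P F a b"
  unfolding pull2_def by (simp add: sum_negf)

lemma pull2_divide: "pull2 P (\<lambda>\<alpha> \<beta>. F \<alpha> \<beta> / c) a b = pull2 P F a b / c"
  unfolding pull2_def by (simp add: sum_divide_distrib)

lemma pull2_swap: "pull2 P (\<lambda>\<alpha> \<beta>. F \<beta> \<alpha>) a b = pull2 P F b a"
  unfolding pull2_def by (subst sum.swap) (simp add: ac_simps)

lemma pull2_of_real: "pull2 P (\<lambda>\<alpha> \<beta>. of_real (F \<alpha> \<beta>)) a b = (of_real (pull2 P F a b) :: complex)"
  unfolding pull2_def by simp

lemma pull2_cnj: "pull2 P (\<lambda>\<alpha> \<beta>. cnj (F \<alpha> \<beta>)) a b = cnj (pull2 P F a b)"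
  unfolding pull2_def by simp

lemma pull2_mat: "pull2 (mat 1) F = F"
proof (intro ext)
  fix a b
  have "pull2 (mat 1) F a b = (\<Sum>\<alpha>\<in>UNIV. \<Sum>\<beta>\<in>UNIV. if \<alpha> = a \<and> \<beta> = b then F \<alpha> \<beta> else 0)"
    unfolding pull2_def mat_def by (intro sum.cong refl) simp
  then show "pull2 (mat 1) F a b = F a b"
    by (simp add: sum_delta2)
qed

lemma sum_product_swap:
  fixes F :: "'a \<Rightarrow> 'b \<Rightarrow> 'c::comm_semiring_1"
  shows "(\<Sum>\<rho>\<in>A. \<Sum>\<sigma>\<in>B. ((\<Sum>a\<in>C. f a \<rho>) * (\<Sum>b\<in>D. h b \<sigma>)) * F \<rho> \<sigma>)
    = (\<Sum>a\<in>C. \<Sum>b\<in>D. \<Sum>\<rho>\<in>A. \<Sum>\<sigma>\<in>B. f a \<rho> * h b \<sigma> * F \<rho> \<sigma>)"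
  unfolding sum_product unfolding sum_distrib_right by (rule sum_swap4)

lemma pull2_pull2: "pull2 Q (pull2 P F) = pull2 (P ** Q) F"
proof (intro ext)
  fix c d
  have "pull2 (P ** Q) F c d = (\<Sum>\<rho>\<in>UNIV. \<Sum>\<sigma>\<in>UNIV.
      ((\<Sum>a\<in>UNIV. of_real (P $ \<rho> $ a * Q $ a $ c)) * (\<Sum>b\<in>UNIV. of_real (P $ \<sigma> $ b * Q $ b $ d))) * F \<rho> \<sigma>)"
    unfolding pull2_def matrix_matrix_mult_def by simp
  also have "\<dots> = pull2 Q (pull2 P F) c d"
    by (rule trans[OF sum_product_swap], unfold pull2_def sum_distrib_left, intro sum.cong refl) (simp add: ac_simps)
  finally show "pull2 Q (pull2 P F) c d = pull2 (P ** Q) F c d" by simp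
qed

lemma raise2_minkowski: "raise2 minkowski F a b = of_real (lsign a * lsign b) * F a b"
proof -
  have "raise2 minkowski F a b
      = (\<Sum>\<rho>\<in>UNIV. \<Sum>\<sigma>\<in>UNIV. if \<rho> = a \<and> \<sigma> = b then of_real (lsign a * lsign b) * F \<rho> \<sigma> else 0)"
    unfolding raise2_def matrix_inv_minkowski minkowski_nth by (intro sum.cong refl) auto
  then show ?thesis by (simp add: sum_delta2)
qed

lemma dot2_minkowski: "dot2 minkowski A B a b = (\<Sum>c\<in>UNIV. of_real (lsign c) * (A a c * B c b))"
proof -
  have "dot2 minkowski A B a b
      = (\<Sum>\<mu>\<in>UNIV. \<Sum>\<nu>\<in>UNIV. (if \<nu> = \<mu> then of_real (lsign \<mu>) * (A a \<mu> * B \<mu> b) else 0))"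
    unfolding dot2_def matrix_inv_minkowski minkowski_nth
    by (intro sum.cong refl) (auto intro!: sum.cong)
  then show ?thesis by simp
qed

section \<open>Transfer of the metric operations to an orthonormal tetrad\<close>

locale tetrad =
  fixes g P Q :: "real^4^4"
  assumes PQ: "P ** Q = mat 1" and QP: "Q ** P = mat 1"
    and ginv: "matrix_inv g = P ** minkowski ** transpose P"
begin

lemma pull2_inverse: "pull2 P (pull2 Q F) = F" "pull2 Q (pull2 P F) = F"
  by (simp_all add: pull2_pull2 PQ QP pull2_mat)

lemma pull2_inject: "pull2 P F = pull2 P H \<longleftrightarrow> F = H"
  by (metis pull2_inverse(2))

lemma pull4_inject: "pull4 P X = pull4 P Y \<longleftrightarrow> X = Y"
proof
  assume eq: "pull4 P X = pull4 P Y"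
  have "pull2 P (\<lambda>\<alpha> \<beta>. X \<alpha> \<beta> \<mu> \<nu>) a b = pull2 P (\<lambda>\<alpha> \<beta>. Y \<alpha> \<beta> \<mu> \<nu>) a b" for \<mu> \<nu> a b
  proof -
    have "pull2 P (\<lambda>\<mu> \<nu>. pull2 P (\<lambda>\<alpha> \<beta>. X \<alpha> \<beta> \<mu> \<nu>) a b) = pull2 P (\<lambda>\<mu> \<nu>. pull2 P (\<lambda>\<alpha> \<beta>. Y \<alpha> \<beta> \<mu> \<nu>) a b)"
      using fun_cong[OF fun_cong[OF eq]] by (simp add: pull4_def)
    then show ?thesis
      unfolding pull2_inject by meson
  qed
  then have "(\<lambda>\<alpha> \<beta>. X \<alpha> \<beta> \<mu> \<nu>) = (\<lambda>\<alpha> \<beta>. Y \<alpha> \<beta> \<mu> \<nu>)" for \<mu> \<nu>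
    using pull2_inject by blast
  then show "X = Y"
    by (intro ext) meson
qed simp

lemma ginv_nth: "matrix_inv g $ \<mu> $ \<rho> = (\<Sum>a\<in>UNIV. P $ \<mu> $ a * lsign a * P $ \<rho> $ a)"
  unfolding ginv matrix_matrix_mult_def transpose_def
  by (simp add: minkowski_nth if_distrib[where f = "\<lambda>x. _ * x"] cong: if_cong)

lemma raise2_tetrad:
  "raise2 g F \<mu> \<nu> = (\<Sum>a\<in>UNIV. \<Sum>b\<in>UNIV. of_real (P $ \<mu> $ a * P $ \<nu> $ b) * raise2 minkowski (pull2 P F) a b)"
proof -
  have "raise2 g F \<mu> \<nu> = (\<Sum>\<rho>\<in>UNIV. \<Sum>\<sigma>\<in>UNIV.
      ((\<Sum>a\<in>UNIV. of_real (P $ \<mu> $ a * lsign a * P $ \<rho> $ a)) * (\<Sum>b\<in>UNIV. of_real (P $ \<nu> $ b * lsign b * P $ \<sigma> $ b))) * F \<rho> \<sigma>)"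
    unfolding raise2_def ginv_nth by simp
  also have "\<dots> = (\<Sum>a\<in>UNIV. \<Sum>b\<in>UNIV. of_real (P $ \<mu> $ a * P $ \<nu> $ b) * raise2 minkowski (pull2 P F) a b)"
    by (rule trans[OF sum_product_swap], unfold raise2_minkowski pull2_def sum_distrib_left, intro sum.cong refl) (simp add: ac_simps)
  finally show ?thesis .
qed

text \<open>The copies of \<open>P\<close> that \<open>raise2_tetrad\<close> leaves on the upper
  indices are absorbed by the lower indices of \<open>H\<close>. Hence \<open>biv_metric\<close>,
  \<open>biv_act\<close> and \<open>hodge\<close> keep their form in the tetrad.\<close>

lemma contract_tetrad:
  "(\<Sum>\<mu>\<in>UNIV. \<Sum>\<nu>\<in>UNIV. H \<mu> \<nu> * raise2 g F \<mu> \<nu>)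
    = (\<Sum>a\<in>UNIV. \<Sum>b\<in>UNIV. pull2 P H a b * raise2 minkowski (pull2 P F) a b)"
proof -
  have "(\<Sum>\<mu>\<in>UNIV. \<Sum>\<nu>\<in>UNIV. H \<mu> \<nu> * raise2 g F \<mu> \<nu>)
     = (\<Sum>\<mu>\<in>UNIV. \<Sum>\<nu>\<in>UNIV. \<Sum>a\<in>UNIV. \<Sum>b\<in>UNIV. H \<mu> \<nu> * (of_real (P $ \<mu> $ a * P $ \<nu> $ b) * raise2 minkowski (pull2 P F) a b))"
    unfolding raise2_tetrad sum_distrib_left ..
  also have "\<dots> = (\<Sum>a\<in>UNIV. \<Sum>b\<in>UNIV. pull2 P H a b * raise2 minkowski (pull2 P F) a b)"
    unfolding pull2_def[of P H] sum_distrib_right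
    by (rule trans[OF sum_swap4], intro sum.cong refl) (simp add: ac_simps)
  finally show ?thesis .
qed

lemma biv_metric_tetrad: "biv_metric g F H = biv_metric minkowski (pull2 P F) (pull2 P H)"
  unfolding biv_metric_def contract_tetrad ..

lemma pull2_biv_act: "pull2 P (biv_act g X F) = biv_act minkowski (pull4 P X) (pull2 P F)"
proof (intro ext)
  fix a b
  have "pull2 P (biv_act g X F) a b
      = (1/2) * (\<Sum>\<mu>\<in>UNIV. \<Sum>\<nu>\<in>UNIV. pull2 P (\<lambda>\<alpha> \<beta>. X \<alpha> \<beta> \<mu> \<nu>) a b * raise2 g F \<mu> \<nu>)"
    unfolding biv_act_def pull2_mult pull2_sum pull2_mult_right ..
  then show "pull2 P (biv_act g X F) a b = biv_act minkowski (pull4 P X) (pull2 P F) a b"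
    unfolding contract_tetrad biv_act_def pull4_def .
qed

lemma hodge_biv_act: "hodge h \<eta> F = biv_act h (\<lambda>\<alpha> \<beta> \<mu> \<nu>. of_real (\<eta> \<alpha> \<beta> \<mu> \<nu>)) F"
  unfolding hodge_def biv_act_def ..

lemma pull2_hodge: "pull2 P (hodge g \<eta> F) = hodge minkowski (pull4 P \<eta>) (pull2 P F)"
  unfolding hodge_biv_act pull2_biv_act pull4_def pull2_of_real ..

lemma pull2_scale2: "pull2 R (scale2 c F) = scale2 c (pull2 R F)"
  unfolding scale2_def fun_eq_iff pull2_mult by simp

lemma SD_tetrad: "F \<in> SD g \<eta> \<longleftrightarrow> pull2 P F \<in> SD minkowski (pull4 P \<eta>)"
proof -
  have "pull2 P (\<lambda>\<alpha> \<beta>. - F \<beta> \<alpha>) a b = - pull2 P F b a" for a b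
    using pull2_minus[of P "\<lambda>\<alpha> \<beta>. F \<beta> \<alpha>"] pull2_swap[of P F] by simp
  then have "(\<forall>\<alpha> \<beta>. pull2 P F \<alpha> \<beta> = - pull2 P F \<beta> \<alpha>) \<longleftrightarrow> pull2 P F = pull2 P (\<lambda>\<alpha> \<beta>. - F \<beta> \<alpha>)"
    by (simp add: fun_eq_iff)
  also have "\<dots> \<longleftrightarrow> (\<forall>\<alpha> \<beta>. F \<alpha> \<beta> = - F \<beta> \<alpha>)"
    unfolding pull2_inject by (simp add: fun_eq_iff)
  finally show ?thesis
    by (simp add: SD_def pull2_hodge[symmetric] pull2_scale2[symmetric] pull2_inject)
qed

text \<open>The dual acts on the first index pair, where \<open>pull2_hodge\<close> applies (fact
  1); it is linear in the second pair, whose pullback therefore moves inside (fact 2).\<close>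

lemma pull4_sd_weyl: "pull4 P (sd_weyl g \<eta> W) = sd_weyl minkowski (pull4 P \<eta>) (pull4 P W)"
proof (intro ext)
  fix a b c d
  have 1: "pull2 P (\<lambda>\<alpha> \<beta>. sd_weyl g \<eta> W \<alpha> \<beta> \<mu> \<nu>) a b
    = (of_real (pull2 P (\<lambda>\<alpha> \<beta>. W \<alpha> \<beta> \<mu> \<nu>) a b)
       - \<i> * hodge minkowski (pull4 P \<eta>) (\<lambda>\<alpha> \<beta>. of_real (pull2 P (\<lambda>\<alpha> \<beta>. W \<alpha> \<beta> \<mu> \<nu>) \<alpha> \<beta>)) a b) / 2" for \<mu> \<nu>
    unfolding sd_weyl_def pull2_divide pull2_diff pull2_mult pull2_hodge pull2_of_real ..
  have 2: "pull2 P (\<lambda>\<mu> \<nu>. hodge minkowski \<eta>' (\<lambda>\<alpha> \<beta>. of_real (X \<alpha> \<beta> \<mu> \<nu>)) a b) c d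
     = hodge minkowski \<eta>' (\<lambda>\<alpha> \<beta>. of_real (pull2 P (X \<alpha> \<beta>) c d)) a b" for \<eta>' X
    unfolding hodge_def pull2_mult pull2_sum raise2_minkowski pull2_of_real ..
  show "pull4 P (sd_weyl g \<eta> W) a b c d = sd_weyl minkowski (pull4 P \<eta>) (pull4 P W) a b c d"
    unfolding pull4_def[of P "sd_weyl g \<eta> W"] 1 pull2_divide pull2_diff pull2_mult 2 pull2_of_real
    unfolding sd_weyl_def pull4_def[of P W] ..
qed

lemma pull2_dot2: "pull2 P (dot2 g A B) = dot2 minkowski (pull2 P A) (pull2 P B)"
proof (intro ext)
  fix c d
  \<comment> \<open>Splitting the inverse metric along the tetrad separates the two contracted
    indices: for each leg \<open>a\<close> there is one factor for \<open>A\<close> and one for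
    \<open>B\<close>.\<close>
  have "dot2 g A B \<alpha> \<beta> = (\<Sum>a\<in>UNIV. of_real (lsign a) *
      ((\<Sum>\<nu>\<in>UNIV. of_real (P $ \<nu> $ a) * A \<alpha> \<nu>) * (\<Sum>\<mu>\<in>UNIV. of_real (P $ \<mu> $ a) * B \<mu> \<beta>)))" for \<alpha> \<beta>
  proof -
    have "dot2 g A B \<alpha> \<beta> = (\<Sum>\<mu>\<in>UNIV. \<Sum>\<nu>\<in>UNIV. \<Sum>a\<in>UNIV.
        of_real (lsign a) * ((of_real (P $ \<nu> $ a) * A \<alpha> \<nu>) * (of_real (P $ \<mu> $ a) * B \<mu> \<beta>)))"
      unfolding dot2_def ginv_nth of_real_sum sum_distrib_left sum_distrib_right
      by (intro sum.cong refl) (simp add: ac_simps)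
    then show ?thesis
      unfolding sum_product unfolding sum_distrib_left by (rule trans[OF _ sum_swap3])
  qed
  then have 1: "dot2 g A B = (\<lambda>\<alpha> \<beta>. \<Sum>a\<in>UNIV. of_real (lsign a) *
      ((\<Sum>\<nu>\<in>UNIV. of_real (P $ \<nu> $ a) * A \<alpha> \<nu>) * (\<Sum>\<mu>\<in>UNIV. of_real (P $ \<mu> $ a) * B \<mu> \<beta>)))"
    by blast
  have "pull2 P (dot2 g A B) c d = (\<Sum>a\<in>UNIV. of_real (lsign a) * (\<Sum>\<alpha>\<in>UNIV. \<Sum>\<beta>\<in>UNIV.
     (of_real (P $ \<alpha> $ c) * (\<Sum>\<nu>\<in>UNIV. of_real (P $ \<nu> $ a) * A \<alpha> \<nu>)) *
     (of_real (P $ \<beta> $ d) * (\<Sum>\<mu>\<in>UNIV. of_real (P $ \<mu> $ a) * B \<mu> \<beta>))))"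
    unfolding 1 pull2_sum pull2_mult unfolding pull2_def
    by (rule sum.cong[OF refl], rule arg_cong2[where f = "(*)", OF refl], intro sum.cong refl) simp
  also have "\<dots> = dot2 minkowski (pull2 P A) (pull2 P B) c d"
  proof -
    have A: "pull2 P A c a = (\<Sum>\<alpha>\<in>UNIV. of_real (P $ \<alpha> $ c) * (\<Sum>\<nu>\<in>UNIV. of_real (P $ \<nu> $ a) * A \<alpha> \<nu>))" for a
      unfolding pull2_def sum_distrib_left by (intro sum.cong refl) simp
    have B: "pull2 P B a d = (\<Sum>\<beta>\<in>UNIV. of_real (P $ \<beta> $ d) * (\<Sum>\<mu>\<in>UNIV. of_real (P $ \<mu> $ a) * B \<mu> \<beta>))" for a
      unfolding pull2_def sum_distrib_left by (subst sum.swap) (intro sum.cong refl, simp)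
    show ?thesis
      unfolding dot2_minkowski A B sum_product by simp
  qed
  finally show "pull2 P (dot2 g A B) c d = dot2 minkowski (pull2 P A) (pull2 P B) c d" .
qed

lemma trace_tetrad:
  "(\<Sum>\<alpha>\<in>UNIV. \<Sum>\<beta>\<in>UNIV. of_real (matrix_inv g $ \<alpha> $ \<beta>) * A \<alpha> \<beta>) = (\<Sum>a\<in>UNIV. of_real (lsign a) * pull2 P A a a)"
proof -
  have "(\<Sum>\<alpha>\<in>UNIV. \<Sum>\<beta>\<in>UNIV. of_real (matrix_inv g $ \<alpha> $ \<beta>) * A \<alpha> \<beta>)
    = (\<Sum>\<alpha>\<in>UNIV. \<Sum>\<beta>\<in>UNIV. \<Sum>a\<in>UNIV. of_real (lsign a) * (of_real (P $ \<alpha> $ a * P $ \<beta> $ a) * A \<alpha> \<beta>))"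
    unfolding ginv_nth of_real_sum sum_distrib_right by (simp add: ac_simps)
  also have "\<dots> = (\<Sum>\<alpha>\<in>UNIV. \<Sum>a\<in>UNIV. \<Sum>\<beta>\<in>UNIV. of_real (lsign a) * (of_real (P $ \<alpha> $ a * P $ \<beta> $ a) * A \<alpha> \<beta>))"
    by (rule sum.cong[OF refl], rule sum.swap)
  also have "\<dots> = (\<Sum>a\<in>UNIV. of_real (lsign a) * pull2 P A a a)"
    unfolding pull2_def sum_distrib_left by (rule sum.swap)
  finally show ?thesis .
qed

end

section \<open>Self-dual bivectors in an orthonormal tetrad\<close>

text \<open>Raising the index 0 changes a sign, whence the opposite signs of the two groups of
  formulas. The value of \<open>e\<close> stays arbitrary because \<open>SD_minkowski_volume\<close>
  uses the formulas to derive e^2 = 1.\<close>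

lemma hodge_minkowski:
  fixes e :: real
  assumes \<eta>: "\<And>\<alpha> \<beta> \<mu> \<nu>. \<eta> \<alpha> \<beta> \<mu> \<nu> = - \<eta> \<beta> \<alpha> \<mu> \<nu>" "\<And>\<alpha> \<beta> \<mu> \<nu>. \<eta> \<alpha> \<beta> \<mu> \<nu> = - \<eta> \<alpha> \<mu> \<beta> \<nu>" "\<And>\<alpha> \<beta> \<mu> \<nu>. \<eta> \<alpha> \<beta> \<mu> \<nu> = - \<eta> \<alpha> \<beta> \<nu> (\<mu>::4)"
    and F: "\<And>\<alpha> \<beta>. F \<alpha> \<beta> = - F \<beta> \<alpha>"
    and e: "e = \<eta> 0 1 2 3"
  shows "hodge minkowski \<eta> F 0 1 = of_real e * F 2 3" "hodge minkowski \<eta> F 0 2 = of_real e * F 3 1" "hodge minkowski \<eta> F 0 3 = of_real e * F 1 2"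
    "hodge minkowski \<eta> F 2 3 = - of_real e * F 0 1" "hodge minkowski \<eta> F 3 1 = - of_real e * F 0 2" "hodge minkowski \<eta> F 1 2 = - of_real e * F 0 3"
    "hodge minkowski \<eta> F \<alpha> \<beta> = - hodge minkowski \<eta> F \<beta> \<alpha>"
proof -
  show "hodge minkowski \<eta> F \<alpha> \<beta> = - hodge minkowski \<eta> F \<beta> \<alpha>"
    unfolding hodge_def by (subst \<eta>(1)) (simp add: sum_negf)
  have z: "\<eta> a a m n = 0" "\<eta> a m m n = 0" "\<eta> a m n n = 0" for a m n
    using \<eta>[of a a m n] \<eta>[of a m m n] \<eta>[of a m n n] by auto
  have z': "\<eta> a m a n = 0" "\<eta> a m n a = 0" "\<eta> m a n a = 0" for a m n
    using \<eta>(1)[of a m a n] \<eta>(3)[of a m n a] \<eta>(3)[of m a n a] by (simp_all add: z)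
  have perm: "\<eta> 0 1 3 2 = -e" "\<eta> 0 2 3 1 = e" "\<eta> 0 2 1 3 = -e" "\<eta> 0 3 1 2 = e" "\<eta> 0 3 2 1 = -e"
    "\<eta> 2 3 0 1 = e" "\<eta> 2 3 1 0 = -e" "\<eta> 3 1 0 2 = e" "\<eta> 3 1 2 0 = -e" "\<eta> 1 2 0 3 = e" "\<eta> 1 2 3 0 = -e"
    using \<eta>(3)[of 0 1 3 2] \<eta>(2)[of 0 2 1 3] \<eta>(3)[of 0 2 3 1] \<eta>(2)[of 0 3 1 2] \<eta>(3)[of 0 3 2 1]
      \<eta>(2)[of 2 3 0 1] \<eta>(1)[of 2 0 3 1] \<eta>(3)[of 2 3 1 0] \<eta>(2)[of 3 1 0 2] \<eta>(1)[of 3 0 1 2] \<eta>(3)[of 3 1 2 0]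
      \<eta>(2)[of 1 2 0 3] \<eta>(1)[of 1 0 2 3] \<eta>(3)[of 1 2 3 0] e by linarith+
  have Fz: "F a a = 0" for a using F[of a a] by simp
  have Fs: "F 1 0 = - F 0 1" "F 2 0 = - F 0 2" "F 3 0 = - F 0 3" "F 3 2 = - F 2 3" "F 1 3 = - F 3 1" "F 2 1 = - F 1 2"
    by (rule F)+
  note s = hodge_def raise2_minkowski sum_4_from_0 lsign_def z z' perm e[symmetric] Fz Fs
  show "hodge minkowski \<eta> F 0 1 = of_real e * F 2 3" "hodge minkowski \<eta> F 0 2 = of_real e * F 3 1" "hodge minkowski \<eta> F 0 3 = of_real e * F 1 2"
    "hodge minkowski \<eta> F 2 3 = - of_real e * F 0 1" "hodge minkowski \<eta> F 3 1 = - of_real e * F 0 2" "hodge minkowski \<eta> F 1 2 = - of_real e * F 0 3"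
    by (simp_all add: s)
qed

text \<open>\<open>x, y, z\<close> are the components \<open>F\<^sub>2\<^sub>3, F\<^sub>3\<^sub>1, F\<^sub>1\<^sub>2\<close>, and \<open>e = \<plusminus>1\<close> is the component \<open>\<eta>\<^sub>0\<^sub>1\<^sub>2\<^sub>3\<close>, i.e. the orientation.\<close>

definition sd_bivector :: "real \<Rightarrow> complex \<Rightarrow> complex \<Rightarrow> complex \<Rightarrow> complex tensor2" where
  "sd_bivector e x y z = (\<lambda>\<alpha> \<beta>.
     if \<alpha> = 0 then (if \<beta> = 1 then - \<i> * e * x else if \<beta> = 2 then - \<i> * e * y else if \<beta> = 3 then - \<i> * e * z else 0)
     else if \<alpha> = 1 then (if \<beta> = 0 then \<i> * e * x else if \<beta> = 2 then z else if \<beta> = 3 then - y else 0)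
     else if \<alpha> = 2 then (if \<beta> = 0 then \<i> * e * y else if \<beta> = 1 then - z else if \<beta> = 3 then x else 0)
     else (if \<beta> = 0 then \<i> * e * z else if \<beta> = 1 then y else if \<beta> = 2 then - x else 0))"

text \<open>The listed pairs represent every unordered pair of distinct indices once. The cyclic
  order 23, 31, 12 gives the duality formulas a uniform sign.\<close>

lemma antisym_ext:
  assumes F: "\<And>\<alpha> \<beta>. F \<alpha> \<beta> = - F \<beta> \<alpha>" and H: "\<And>\<alpha> \<beta>. H \<alpha> \<beta> = - H \<beta> (\<alpha>::4)"
    and "F 0 1 = H 0 1" "F 0 2 = H 0 2" "F 0 3 = H 0 3" "F 2 3 = H 2 3" "F 3 1 = H 3 1" "F 1 2 = H 1 2"
  shows "F = (H :: complex tensor2)"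
proof -
  have "F a a = 0" "H a a = 0" for a using F[of a a] H[of a a] by simp_all
  moreover have "F 1 0 = H 1 0" "F 2 0 = H 2 0" "F 3 0 = H 3 0" "F 3 2 = H 3 2" "F 1 3 = H 1 3" "F 2 1 = H 2 1"
    unfolding F[of 1 0] F[of 2 0] F[of 3 0] F[of 3 2] F[of 1 3] F[of 2 1]
      H[of 1 0] H[of 2 0] H[of 3 0] H[of 3 2] H[of 1 3] H[of 2 1] assms(3-) by (rule refl)+
  ultimately have "\<forall>a b. F a b = H a b"
    using assms(3-) by (simp add: forall_4_from_0)
  then show ?thesis by (intro ext) simp
qed

locale minkowski_volume =
  fixes \<eta> :: "real tensor4" and e :: real
  assumes eta_antisym: "\<And>\<alpha> \<beta> \<mu> \<nu>. \<eta> \<alpha> \<beta> \<mu> \<nu> = - \<eta> \<beta> \<alpha> \<mu> \<nu>"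
      "\<And>\<alpha> \<beta> \<mu> \<nu>. \<eta> \<alpha> \<beta> \<mu> \<nu> = - \<eta> \<alpha> \<mu> \<beta> \<nu>" "\<And>\<alpha> \<beta> \<mu> \<nu>. \<eta> \<alpha> \<beta> \<mu> \<nu> = - \<eta> \<alpha> \<beta> \<nu> \<mu>"
    and e_def: "e = \<eta> 0 1 2 3" and e_sq: "e * e = 1"
begin

lemmas hodge_nth = hodge_minkowski[OF eta_antisym _ e_def]

lemma e_sign: "e = 1 \<or> e = -1"
  using e_sq square_eq_1_iff by blast

lemma hodge_hodge:
  assumes F: "\<And>\<alpha> \<beta>. F \<alpha> \<beta> = - F \<beta> \<alpha>"
  shows "hodge minkowski \<eta> (hodge minkowski \<eta> F) \<alpha> \<beta> = - F \<alpha> \<beta>"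
proof -
  note h1 = hodge_nth[of F, OF F]
  note h2 = hodge_nth[of "hodge minkowski \<eta> F", OF h1(7)]
  have ee: "complex_of_real e * (complex_of_real e * x) = x" for x
    using e_sign by auto
  have "hodge minkowski \<eta> (hodge minkowski \<eta> F) = (\<lambda>\<alpha> \<beta>. - F \<alpha> \<beta>)"
  proof (rule antisym_ext)
    show "hodge minkowski \<eta> (hodge minkowski \<eta> F) \<alpha> \<beta> = - hodge minkowski \<eta> (hodge minkowski \<eta> F) \<beta> \<alpha>" for \<alpha> \<beta>
      by (rule h2(7))
    show "- F \<alpha> \<beta> = - (- F \<beta> \<alpha>)" for \<alpha> \<beta> by (rule arg_cong[OF F])
  qed (simp_all only: h1(1-6) h2(1-6), simp_all add: ee)
  then show ?thesis by (simp add: fun_eq_iff)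
qed

lemma sd_bivector_SD: "sd_bivector e x y z \<in> SD minkowski \<eta>"
proof -
  have A: "sd_bivector e x y z \<alpha> \<beta> = - sd_bivector e x y z \<beta> \<alpha>" for \<alpha> \<beta>
  proof -
    have "\<forall>\<alpha> \<beta>. sd_bivector e x y z \<alpha> \<beta> = - sd_bivector e x y z \<beta> \<alpha>"
      by (simp add: forall_4_from_0 sd_bivector_def)
    then show ?thesis by blast
  qed
  have "hodge minkowski \<eta> (sd_bivector e x y z) = scale2 \<i> (sd_bivector e x y z)"
  proof (rule antisym_ext)
    show "hodge minkowski \<eta> (sd_bivector e x y z) \<alpha> \<beta> = - hodge minkowski \<eta> (sd_bivector e x y z) \<beta> \<alpha>" for \<alpha> \<beta>
      by (rule hodge_nth(7)) (rule A)
    show "scale2 \<i> (sd_bivector e x y z) \<alpha> \<beta> = - scale2 \<i> (sd_bivector e x y z) \<beta> \<alpha>" for \<alpha> \<beta>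
      unfolding scale2_def by (subst A) simp
  qed (simp_all only: hodge_nth(1-6)[of "sd_bivector e x y z", OF A] scale2_def, insert e_sign, auto simp: sd_bivector_def)
  then show ?thesis
    using A unfolding SD_def by blast
qed

text \<open>Self-duality says that F is -i times its dual, which expresses each F_0i by the
  complementary spatial component; three complex parameters remain.\<close>

lemma SD_sd_bivector:
  assumes "F \<in> SD minkowski \<eta>"
  shows "F = sd_bivector e (F 2 3) (F 3 1) (F 1 2)"
proof -
  have F: "F \<alpha> \<beta> = - F \<beta> \<alpha>" and sd: "hodge minkowski \<eta> F \<alpha> \<beta> = \<i> * F \<alpha> \<beta>" for \<alpha> \<beta>
    using assms unfolding SD_def scale2_def fun_eq_iff by blast+
  have rot: "F \<alpha> \<beta> = - \<i> * hodge minkowski \<eta> F \<alpha> \<beta>" for \<alpha> \<beta>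
    by (simp add: sd)
  have F0: "F 0 1 = - \<i> * e * F 2 3" "F 0 2 = - \<i> * e * F 3 1" "F 0 3 = - \<i> * e * F 1 2"
    using rot[of 0 1] rot[of 0 2] rot[of 0 3] unfolding hodge_nth(1-6)[of F, OF F] by simp_all
  have asym: "sd_bivector e x y z \<alpha> \<beta> = - sd_bivector e x y z \<beta> \<alpha>" for x y z \<alpha> \<beta>
    using sd_bivector_SD unfolding SD_def by blast
  show ?thesis
    by (rule antisym_ext[OF F asym]) (simp_all add: sd_bivector_def F0)
qed

lemma SD_cases:
  assumes "F \<in> SD minkowski \<eta>"
  obtains x y z where "F = sd_bivector e x y z"
  using SD_sd_bivector[OF assms] by blast

text \<open>The conjugate of \<open>K\<close> is anti-self-dual. Bivectors of opposite duality
  commute as endomorphisms and are orthogonal, which gives the symmetry and the vanishing trace of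
  the product. Both are checked in components for each orientation.\<close>

lemma dot2_cnj_sym_traceless:
  assumes "F \<in> SD minkowski \<eta>" "K \<in> SD minkowski \<eta>"
  shows "dot2 minkowski F (\<lambda>\<alpha> \<beta>. cnj (K \<alpha> \<beta>)) \<alpha> \<beta> = dot2 minkowski F (\<lambda>\<alpha> \<beta>. cnj (K \<alpha> \<beta>)) \<beta> \<alpha>"
    and "(\<Sum>a\<in>UNIV. of_real (lsign a) * dot2 minkowski F (\<lambda>\<alpha> \<beta>. cnj (K \<alpha> \<beta>)) a a) = 0"
proof -
  obtain x y z u v w where FK: "F = sd_bivector e x y z" "K = sd_bivector e u v w"
    using SD_cases assms by metis
  have "\<forall>\<alpha> \<beta>. dot2 minkowski F (\<lambda>\<alpha> \<beta>. cnj (K \<alpha> \<beta>)) \<alpha> \<beta> = dot2 minkowski F (\<lambda>\<alpha> \<beta>. cnj (K \<alpha> \<beta>)) \<beta> \<alpha>"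
    unfolding FK dot2_minkowski using e_sign
    by (elim disjE; simp add: forall_4_from_0 sum_4_from_0 sd_bivector_def lsign_def algebra_simps)
  then show "dot2 minkowski F (\<lambda>\<alpha> \<beta>. cnj (K \<alpha> \<beta>)) \<alpha> \<beta> = dot2 minkowski F (\<lambda>\<alpha> \<beta>. cnj (K \<alpha> \<beta>)) \<beta> \<alpha>"
    by blast
  show "(\<Sum>a\<in>UNIV. of_real (lsign a) * dot2 minkowski F (\<lambda>\<alpha> \<beta>. cnj (K \<alpha> \<beta>)) a a) = 0"
    unfolding FK dot2_minkowski using e_sign
    by (elim disjE; simp add: sum_4_from_0 sd_bivector_def lsign_def algebra_simps)
qed

text \<open>By commutation the contraction is the trace of F H times that of conjugates K L under
  one trace. Each of the two products is a scalar plus a bivector of its own duality, and only the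
  scalars, -1/2 times the bivector metrics, survive. The check itself is in components.\<close>

lemma dot2_cnj_inner:
  assumes "F \<in> SD minkowski \<eta>" "K \<in> SD minkowski \<eta>" "H \<in> SD minkowski \<eta>" "L \<in> SD minkowski \<eta>"
  shows "(\<Sum>a\<in>UNIV. \<Sum>b\<in>UNIV. dot2 minkowski F (\<lambda>\<alpha> \<beta>. cnj (K \<alpha> \<beta>)) a b *
      raise2 minkowski (dot2 minkowski H (\<lambda>\<alpha> \<beta>. cnj (L \<alpha> \<beta>))) a b)
    = biv_metric minkowski F H * cnj (biv_metric minkowski K L)"
proof -
  obtain x y z u v w where FK: "F = sd_bivector e x y z" "K = sd_bivector e u v w"
    using SD_cases assms by metis
  obtain x' y' z' u' v' w' where HL: "H = sd_bivector e x' y' z'" "L = sd_bivector e u' v' w'"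
    using SD_cases assms by metis
  show ?thesis
    unfolding FK HL dot2_minkowski raise2_minkowski biv_metric_def using e_sign
    by (elim disjE; simp add: sum_4_from_0 sd_bivector_def lsign_def; simp add: algebra_simps)
qed

text \<open>Nine coefficients face nine free components of \<open>A\<close>, and the linear system
  is solved explicitly. The bivectors are left existential because the later expansion in
  \<open>U\<close> accepts any self-dual factors.\<close>

lemma sym_traceless_minkowski:
  assumes sym: "\<And>\<alpha> \<beta>. A \<alpha> \<beta> = A \<beta> \<alpha>" and tr: "(\<Sum>a\<in>UNIV. complex_of_real (lsign a) * A a a) = 0"
  shows "\<exists>B :: 3 \<Rightarrow> complex tensor2. \<exists>c. range B \<subseteq> SD minkowski \<eta> \<and>
    A = (\<lambda>\<alpha> \<beta>. \<Sum>i\<in>UNIV. \<Sum>j\<in>UNIV. c i j * dot2 minkowski (B i) (\<lambda>\<alpha> \<beta>. cnj (B j \<alpha> \<beta>)) \<alpha> \<beta>)"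
proof -
  define B :: "3 \<Rightarrow> complex tensor2" where
    "B i = (if i = 1 then sd_bivector e 1 0 0 else if i = 2 then sd_bivector e 0 1 0 else sd_bivector e 0 0 1)" for i
  \<comment> \<open>Solution of the system: c_ij is half of A_ij - \<delta>_ij A_00 - i e
    \<epsilon>_ijk A_0k, summed over k. The \<open>else\<close> branches are the index 3.\<close>
  define c :: "3 \<Rightarrow> 3 \<Rightarrow> complex" where
    "c i j = (if i = 1 then (if j = 1 then A 1 1 - A 0 0 else if j = 2 then A 1 2 - \<i> * e * A 0 3 else A 1 3 + \<i> * e * A 0 2)
      else if i = 2 then (if j = 1 then A 1 2 + \<i> * e * A 0 3 else if j = 2 then A 2 2 - A 0 0 else A 2 3 - \<i> * e * A 0 1)
      else (if j = 1 then A 1 3 - \<i> * e * A 0 2 else if j = 2 then A 2 3 + \<i> * e * A 0 1 else A 3 3 - A 0 0)) / 2" for i j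
  have A: "A 1 0 = A 0 1" "A 2 0 = A 0 2" "A 3 0 = A 0 3" "A 2 1 = A 1 2" "A 3 1 = A 1 3" "A 3 2 = A 2 3"
    by (rule sym)+
  have t: "A 0 0 = A 1 1 + A 2 2 + A 3 3"
  proof -
    have "A 1 1 - A 0 0 + A 2 2 + A 3 3 = 0"
      using tr by (simp add: sum_4_from_0 lsign_def)
    then show ?thesis by algebra
  qed
  have "\<forall>\<alpha> \<beta>. A \<alpha> \<beta> = (\<Sum>i\<in>UNIV. \<Sum>j\<in>UNIV. c i j * dot2 minkowski (B i) (\<lambda>\<alpha> \<beta>. cnj (B j \<alpha> \<beta>)) \<alpha> \<beta>)"
    unfolding dot2_minkowski sum_3 c_def B_def using e_sign
    by (elim disjE; simp add: forall_4_from_0 sum_4_from_0 sd_bivector_def lsign_def A t; simp add: field_simps)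
  moreover have "range B \<subseteq> SD minkowski \<eta>"
    unfolding B_def using sd_bivector_SD by auto
  ultimately show ?thesis
    by (intro exI[of _ B] exI[of _ c]) (simp add: fun_eq_iff)
qed

end

section \<open>Weyl tensors in an orthonormal tetrad\<close>

locale minkowski_weyl = minkowski_volume +
  fixes W :: "real tensor4"
  assumes W_antisym: "\<And>\<alpha> \<beta> \<mu> \<nu>. W \<alpha> \<beta> \<mu> \<nu> = - W \<beta> \<alpha> \<mu> \<nu>" "\<And>\<alpha> \<beta> \<mu> \<nu>. W \<alpha> \<beta> \<mu> \<nu> = - W \<alpha> \<beta> \<nu> \<mu>"
    and W_pair: "\<And>\<alpha> \<beta> \<mu> \<nu>. W \<alpha> \<beta> \<mu> \<nu> = W \<mu> \<nu> \<alpha> \<beta>"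
    and W_Bianchi: "\<And>\<alpha> \<beta> \<mu> \<nu>. W \<alpha> \<beta> \<mu> \<nu> + W \<alpha> \<mu> \<nu> \<beta> + W \<alpha> \<nu> \<beta> \<mu> = 0"
    and W_trace: "\<And>\<beta> \<nu>. (\<Sum>a\<in>UNIV. lsign a * W a \<beta> a \<nu>) = 0"
begin

lemma W_swap:
  "W 1 0 m n = - W 0 1 m n" "W 2 0 m n = - W 0 2 m n" "W 3 0 m n = - W 0 3 m n"
  "W 3 2 m n = - W 2 3 m n" "W 1 3 m n = - W 3 1 m n" "W 2 1 m n = - W 1 2 m n"
  "W m n 1 0 = - W m n 0 1" "W m n 2 0 = - W m n 0 2" "W m n 3 0 = - W m n 0 3"
  "W m n 3 2 = - W m n 2 3" "W m n 1 3 = - W m n 3 1" "W m n 2 1 = - W m n 1 2"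
  by (rule W_antisym)+

lemma W_diag: "W a a m n = 0" "W m n a a = 0"
  using W_antisym(1)[of a a m n] W_antisym(2)[of m n a a] by simp_all

lemma W_ordered:
  "W 0 2 0 1 = W 0 1 0 2" "W 0 3 0 1 = W 0 1 0 3" "W 0 3 0 2 = W 0 2 0 3"
  "W 2 3 0 1 = W 0 1 2 3" "W 3 1 0 1 = W 0 1 3 1" "W 1 2 0 1 = W 0 1 1 2"
  "W 2 3 0 2 = W 0 2 2 3" "W 3 1 0 2 = W 0 2 3 1" "W 1 2 0 2 = W 0 2 1 2"
  "W 2 3 0 3 = W 0 3 2 3" "W 3 1 0 3 = W 0 3 3 1" "W 1 2 0 3 = W 0 3 1 2"
  "W 3 1 2 3 = W 2 3 3 1" "W 1 2 2 3 = W 2 3 1 2" "W 1 2 3 1 = W 3 1 1 2"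
  by (rule W_pair)+

text \<open>Consider the 3x3 blocks indexed by 01, 02, 03 and 23, 31, 12. The 0i traces make the
  magnetic block symmetric; the spatial traces, with the 00 trace for the diagonal, make the spatial
  block minus the electric one.\<close>

lemma W_electric_magnetic:
  "W 0 2 2 3 = W 0 1 3 1" "W 0 3 2 3 = W 0 1 1 2" "W 0 3 3 1 = W 0 2 1 2"
  "W 2 3 2 3 = - W 0 1 0 1" "W 3 1 3 1 = - W 0 2 0 2" "W 1 2 1 2 = - W 0 3 0 3"
  "W 2 3 3 1 = - W 0 1 0 2" "W 2 3 1 2 = - W 0 1 0 3" "W 3 1 1 2 = - W 0 2 0 3"
  using W_trace[of 0 0] W_trace[of 1 1] W_trace[of 2 2] W_trace[of 3 3] W_trace[of 0 1] W_trace[of 0 2] W_trace[of 0 3]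
    W_trace[of 1 2] W_trace[of 1 3] W_trace[of 2 3]
  by (simp_all add: sum_4_from_0 lsign_def W_swap W_diag W_ordered)

abbreviation dual_weyl :: "complex tensor4" where
  "dual_weyl \<equiv> \<lambda>\<alpha> \<beta> \<mu> \<nu>. hodge minkowski \<eta> (\<lambda>\<rho> \<sigma>. complex_of_real (W \<rho> \<sigma> \<mu> \<nu>)) \<alpha> \<beta>"

lemma of_real_W_antisym: "complex_of_real (W \<rho> \<sigma> \<mu> \<nu>) = - complex_of_real (W \<sigma> \<rho> \<mu> \<nu>)"
  by (subst W_antisym(1)) simp

lemmas dual_weyl_nth = hodge_nth[of "\<lambda>\<rho> \<sigma>. complex_of_real (W \<rho> \<sigma> \<mu> \<nu>)" for \<mu> \<nu>, OF of_real_W_antisym]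

lemma dual_weyl_antisym: "dual_weyl \<alpha> \<beta> \<mu> \<nu> = - dual_weyl \<alpha> \<beta> \<nu> \<mu>"
  unfolding hodge_def raise2_minkowski
  by (subst W_antisym(2)) (simp add: sum_negf)

text \<open>The dual exchanges electric and magnetic blocks up to sign, and the result is again
  symmetric by \<open>W_electric_magnetic\<close>; this is where tracelessness enters.
  \<open>antisym_ext\<close> is used twice: in the second pair for six basic first pairs, then in
  the first pair.\<close>

lemma dual_weyl_pair: "dual_weyl \<alpha> \<beta> \<mu> \<nu> = dual_weyl \<mu> \<nu> \<alpha> \<beta>"
proof -
  have 1: "dual_weyl a b m n = dual_weyl m n a b"
    if "(a, b) \<in> {(0,1), (0,2), (0,3), (2,3), (3,1), (1,2)}" for a b m n
  proof -
    have "dual_weyl a b = (\<lambda>m n. dual_weyl m n a b)"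
    proof (rule antisym_ext)
      show "dual_weyl a b \<alpha> \<beta> = - dual_weyl a b \<beta> \<alpha>" for \<alpha> \<beta>
        by (rule dual_weyl_antisym)
      show "dual_weyl \<alpha> \<beta> a b = - dual_weyl \<beta> \<alpha> a b" for \<alpha> \<beta>
        by (rule dual_weyl_nth(7))
    qed (insert that, auto simp: dual_weyl_nth(1-6) W_swap W_diag W_ordered W_electric_magnetic)
    then show ?thesis by meson
  qed
  have "(\<lambda>\<alpha> \<beta>. dual_weyl \<alpha> \<beta> \<mu> \<nu>) = (\<lambda>\<alpha> \<beta>. dual_weyl \<mu> \<nu> \<alpha> \<beta>)"
  proof (rule antisym_ext)
    show "dual_weyl \<alpha> \<beta> \<mu> \<nu> = - dual_weyl \<beta> \<alpha> \<mu> \<nu>" for \<alpha> \<beta>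
      by (rule dual_weyl_nth(7))
    show "dual_weyl \<mu> \<nu> \<alpha> \<beta> = - dual_weyl \<mu> \<nu> \<beta> \<alpha>" for \<alpha> \<beta>
      by (rule dual_weyl_antisym)
  qed (rule 1, simp)+
  then show ?thesis by meson
qed

lemma sd_weyl_pair: "sd_weyl minkowski \<eta> W \<alpha> \<beta> \<mu> \<nu> = sd_weyl minkowski \<eta> W \<mu> \<nu> \<alpha> \<beta>"
  unfolding sd_weyl_def using W_pair[of \<alpha> \<beta> \<mu> \<nu>] dual_weyl_pair[of \<alpha> \<beta> \<mu> \<nu>] by simp

lemma hodge_diff_mult:
  "hodge minkowski \<eta> (\<lambda>\<alpha> \<beta>. (F \<alpha> \<beta> - c * H \<alpha> \<beta>) / 2) \<alpha> \<beta> = (hodge minkowski \<eta> F \<alpha> \<beta> - c * hodge minkowski \<eta> H \<alpha> \<beta>) / 2"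
  unfolding hodge_def raise2_minkowski sum_distrib_left sum_divide_distrib sum_subtractf[symmetric]
  by (intro sum.cong refl) (simp add: algebra_simps diff_divide_distrib)

text \<open>Because the dual squares to -1, half of 1 - i times the dual projects onto its
  eigenspace for i.\<close>

lemma sd_weyl_SD: "(\<lambda>\<alpha> \<beta>. sd_weyl minkowski \<eta> W \<alpha> \<beta> \<mu> \<nu>) \<in> SD minkowski \<eta>"
proof -
  have "hodge minkowski \<eta> (\<lambda>\<alpha> \<beta>. sd_weyl minkowski \<eta> W \<alpha> \<beta> \<mu> \<nu>) \<alpha> \<beta> = \<i> * sd_weyl minkowski \<eta> W \<alpha> \<beta> \<mu> \<nu>" for \<alpha> \<beta>
    unfolding sd_weyl_def hodge_diff_mult hodge_hodge[of "\<lambda>\<rho> \<sigma>. complex_of_real (W \<rho> \<sigma> \<mu> \<nu>)", OF of_real_W_antisym]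
    by (simp add: field_simps)
  moreover have "sd_weyl minkowski \<eta> W \<alpha> \<beta> \<mu> \<nu> = - sd_weyl minkowski \<eta> W \<beta> \<alpha> \<mu> \<nu>" for \<alpha> \<beta>
    unfolding sd_weyl_def by (subst of_real_W_antisym, subst dual_weyl_nth(7)) (simp add: field_simps)
  ultimately show ?thesis
    unfolding SD_def scale2_def fun_eq_iff by blast
qed

text \<open>The metric trace is the difference of the spatial and the time-space diagonal
  components. The terms from \<open>W\<close> cancel by the 00 trace, those from its dual by the
  Bianchi identity, which makes the magnetic block trace-free.\<close>

lemma biv_trace_sd_weyl: "biv_trace minkowski (sd_weyl minkowski \<eta> W) = 0"
proof -
  define X where "X = sd_weyl minkowski \<eta> W"
  have X1: "X a b m n = - X b a m n" for a b m n
    using sd_weyl_SD unfolding X_def SD_def by blast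
  have X2: "X a b m n = - X a b n m" for a b m n
    using X1[of m n a b] unfolding X_def by (simp only: sd_weyl_pair[of a b m n] sd_weyl_pair[of a b n m])
  have Xd: "X a a a a = 0" for a
    using X1[of a a a a] by simp
  have Xs: "X b a b a = X a b a b" for a b
    using X1[of b a b a] X2[of a b b a] by simp
  have "W 0 1 0 1 + W 0 2 0 2 + W 0 3 0 3 = 0"
    using W_trace[of 0 0] by (simp add: sum_4_from_0 lsign_def W_swap W_diag)
  then have "W 0 3 0 3 = - W 0 1 0 1 - W 0 2 0 2" by simp
  then have 0: "complex_of_real (W 0 3 0 3) = - of_real (W 0 1 0 1) - of_real (W 0 2 0 2)" by simp
  have "W 0 1 2 3 + W 0 2 3 1 + W 0 3 1 2 = 0"
    by (rule W_Bianchi)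
  then have "W 0 3 1 2 = - W 0 1 2 3 - W 0 2 3 1" by simp
  then have 1: "complex_of_real (W 0 3 1 2) = - of_real (W 0 1 2 3) - of_real (W 0 2 3 1)" by simp
  have "X 0 1 0 1 + X 0 2 0 2 + X 0 3 0 3 = X 2 3 2 3 + X 3 1 3 1 + X 1 2 1 2"
    unfolding X_def sd_weyl_def dual_weyl_nth(1-6)
    by (simp add: W_ordered W_electric_magnetic 0 1 field_simps)
  then show ?thesis
    unfolding biv_trace_def raise2_minkowski X_def[symmetric]
    by (simp add: sum_4_from_0 lsign_def Xd Xs[of 0 1] Xs[of 0 2] Xs[of 0 3] Xs[of 2 3] Xs[of 3 1] Xs[of 1 2] algebra_simps)
qed

end

section \<open>Transfer to an arbitrary basis\<close>

lemma sum_fun_apply: "(\<Sum>i\<in>I. f i) x = (\<Sum>i\<in>I. (f i x :: 'b::comm_monoid_add))"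
  by (induction I rule: infinite_finite_induct) simp_all

section \<open>Symmetries of 4-tensors under change of basis\<close>

lemma pull4_sum:
  "pull4 P X a b c d = (\<Sum>\<alpha>\<in>UNIV. \<Sum>\<beta>\<in>UNIV. \<Sum>\<mu>\<in>UNIV. \<Sum>\<nu>\<in>UNIV.
    of_real (P $ \<alpha> $ a * P $ \<beta> $ b * P $ \<mu> $ c * P $ \<nu> $ d) * X \<alpha> \<beta> \<mu> \<nu>)"
  unfolding pull4_def pull2_def sum_distrib_left
  by (subst sum_swap4, intro sum.cong refl) (simp add: ac_simps)

lemma pull4_swap:
  "pull4 P (\<lambda>\<alpha> \<beta> \<mu> \<nu>. X \<beta> \<alpha> \<mu> \<nu>) a b c d = pull4 P X b a c d"
  "pull4 P (\<lambda>\<alpha> \<beta> \<mu> \<nu>. X \<alpha> \<mu> \<beta> \<nu>) a b c d = pull4 P X a c b d"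
  "pull4 P (\<lambda>\<alpha> \<beta> \<mu> \<nu>. X \<alpha> \<beta> \<nu> \<mu>) a b c d = pull4 P X a b d c"
  "pull4 P (\<lambda>\<alpha> \<beta> \<mu> \<nu>. X \<mu> \<nu> \<alpha> \<beta>) a b c d = pull4 P X c d a b"
  unfolding pull4_sum
  subgoal by (rule trans[OF sum.swap]) (simp add: ac_simps)
  subgoal by (rule sum.cong[OF refl], rule trans[OF sum.swap]) (simp add: ac_simps)
  subgoal by (rule sum.cong[OF refl], rule sum.cong[OF refl], rule trans[OF sum.swap]) (simp add: ac_simps)
  subgoal by (rule trans[OF sum_swap4]) (simp add: ac_simps)
  done

lemma pull4_minus: "pull4 P (\<lambda>\<alpha> \<beta> \<mu> \<nu>. - X \<alpha> \<beta> \<mu> \<nu>) a b c d = - pull4 P X a b c d"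
  unfolding pull4_sum by (simp add: sum_negf)

lemma pull4_add: "pull4 P (\<lambda>\<alpha> \<beta> \<mu> \<nu>. X \<alpha> \<beta> \<mu> \<nu> + Y \<alpha> \<beta> \<mu> \<nu>) a b c d = pull4 P X a b c d + pull4 P Y a b c d"
  unfolding pull4_sum by (simp add: sum.distrib algebra_simps)

lemma pull4_antisym:
  assumes "\<And>\<alpha> \<beta> \<mu> \<nu>. X \<alpha> \<beta> \<mu> \<nu> = - X \<beta> \<alpha> \<mu> \<nu>"
  shows "pull4 P X a b c d = - pull4 P X b a c d"
  using pull4_minus[of P "\<lambda>\<alpha> \<beta> \<mu> \<nu>. X \<beta> \<alpha> \<mu> \<nu>" a b c d, folded assms] pull4_swap(1)[of P X a b c d] by simp

lemma pull4_antisym_middle: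
  assumes "\<And>\<alpha> \<beta> \<mu> \<nu>. X \<alpha> \<beta> \<mu> \<nu> = - X \<alpha> \<mu> \<beta> \<nu>"
  shows "pull4 P X a b c d = - pull4 P X a c b d"
  using pull4_minus[of P "\<lambda>\<alpha> \<beta> \<mu> \<nu>. X \<alpha> \<mu> \<beta> \<nu>" a b c d, folded assms] pull4_swap(2)[of P X a b c d] by simp

lemma pull4_antisym_right:
  assumes "\<And>\<alpha> \<beta> \<mu> \<nu>. X \<alpha> \<beta> \<mu> \<nu> = - X \<alpha> \<beta> \<nu> \<mu>"
  shows "pull4 P X a b c d = - pull4 P X a b d c"
  using pull4_minus[of P "\<lambda>\<alpha> \<beta> \<mu> \<nu>. X \<alpha> \<beta> \<nu> \<mu>" a b c d, folded assms] pull4_swap(3)[of P X a b c d] by simp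

lemma pull4_pair:
  assumes "\<And>\<alpha> \<beta> \<mu> \<nu>. X \<alpha> \<beta> \<mu> \<nu> = X \<mu> \<nu> \<alpha> \<beta>"
  shows "pull4 P X a b c d = pull4 P X c d a b"
  by (subst pull4_swap(4)[symmetric]) (simp only: assms[symmetric])

lemma pull4_Bianchi:
  assumes "\<And>\<alpha> \<beta> \<mu> \<nu>. X \<alpha> \<beta> \<mu> \<nu> + X \<alpha> \<mu> \<nu> \<beta> + X \<alpha> \<nu> \<beta> \<mu> = 0"
  shows "pull4 P X a b c d + pull4 P X a c d b + pull4 P X a d b c = 0"
proof -
  have 1: "pull4 P (\<lambda>\<alpha> \<beta> \<mu> \<nu>. X \<alpha> \<mu> \<nu> \<beta>) a b c d = pull4 P X a c d b"
    using pull4_swap(2)[of P "\<lambda>\<alpha> \<beta> \<mu> \<nu>. X \<alpha> \<beta> \<nu> \<mu>" a b c d] pull4_swap(3)[of P X a c b d] by simp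
  have 2: "pull4 P (\<lambda>\<alpha> \<beta> \<mu> \<nu>. X \<alpha> \<nu> \<beta> \<mu>) a b c d = pull4 P X a d b c"
    using pull4_swap(3)[of P "\<lambda>\<alpha> \<beta> \<mu> \<nu>. X \<alpha> \<mu> \<beta> \<nu>" a b c d] pull4_swap(2)[of P X a b d c] by simp
  have "pull4 P X a b c d + pull4 P X a c d b + pull4 P X a d b c
    = pull4 P (\<lambda>\<alpha> \<beta> \<mu> \<nu>. X \<alpha> \<beta> \<mu> \<nu> + X \<alpha> \<mu> \<nu> \<beta> + X \<alpha> \<nu> \<beta> \<mu>) a b c d"
    unfolding pull4_add 1 2 ..
  then show ?thesis
    unfolding assms by (simp add: pull4_sum)
qed

text \<open>Swapping the middle indices brings the contracted pair into the inner
  \<open>pull2\<close>, where \<open>trace_tetrad\<close> applies.\<close>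

lemma (in tetrad) pull4_trace:
  fixes W :: "real tensor4"
  assumes "\<And>\<beta> \<nu>. (\<Sum>\<alpha>\<in>UNIV. \<Sum>\<mu>\<in>UNIV. matrix_inv g $ \<alpha> $ \<mu> * W \<alpha> \<beta> \<mu> \<nu>) = 0"
  shows "(\<Sum>a\<in>UNIV. lsign a * pull4 P W a b a d) = 0"
proof -
  have "(\<Sum>a\<in>UNIV. lsign a * pull4 P W a b a d)
    = (\<Sum>a\<in>UNIV. lsign a * pull4 P (\<lambda>\<alpha> \<beta> \<mu> \<nu>. W \<alpha> \<mu> \<beta> \<nu>) a a b d)"
    unfolding pull4_swap(2)[of P W] ..
  also have "\<dots> = pull2 P (\<lambda>\<beta> \<nu>. \<Sum>a\<in>UNIV. lsign a * pull2 P (\<lambda>\<alpha> \<mu>. W \<alpha> \<beta> \<mu> \<nu>) a a) b d"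
    unfolding pull4_def pull2_sum pull2_mult ..
  also have "\<dots> = 0"
    using trace_tetrad[of "\<lambda>\<alpha> \<mu>. W \<alpha> \<beta> \<mu> \<nu>" for \<beta> \<nu>, symmetric] assms by (simp add: pull2_def)
  finally show ?thesis .
qed

text \<open>A nonzero SD bivector forces \<open>*\<^sup>2 = -1\<close>, hence \<open>\<eta>\<^sub>0\<^sub>1\<^sub>2\<^sub>3 = \<plusminus>1\<close>; this replaces the transformation of the normalization
  of \<open>\<eta>\<close> under a change of basis.\<close>

lemma SD_minkowski_volume:
  assumes \<eta>: "\<And>\<alpha> \<beta> \<mu> \<nu>. \<eta> \<alpha> \<beta> \<mu> \<nu> = - \<eta> \<beta> \<alpha> \<mu> \<nu>" "\<And>\<alpha> \<beta> \<mu> \<nu>. \<eta> \<alpha> \<beta> \<mu> \<nu> = - \<eta> \<alpha> \<mu> \<beta> \<nu>" "\<And>\<alpha> \<beta> \<mu> \<nu>. \<eta> \<alpha> \<beta> \<mu> \<nu> = - \<eta> \<alpha> \<beta> \<nu> (\<mu>::4)"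
    and "F \<in> SD minkowski \<eta>" "F \<noteq> 0"
  shows "minkowski_volume \<eta> (\<eta> 0 1 2 3)"
proof
  define e where "e = \<eta> 0 1 2 3"
  have F: "F \<alpha> \<beta> = - F \<beta> \<alpha>" and sd: "hodge minkowski \<eta> F \<alpha> \<beta> = \<i> * F \<alpha> \<beta>" for \<alpha> \<beta>
    using assms(4) unfolding SD_def scale2_def fun_eq_iff by blast+
  note h = hodge_minkowski[of \<eta> F e, OF \<eta> F e_def, unfolded sd]
  have "e * e = 1"
  proof (rule ccontr)
    assume ne: "e * e \<noteq> 1"
    \<comment> \<open>The components F_0i and F_jk form three such pairs; eliminating x leaves (e^2
      - 1) y = 0.\<close>
    have *: "x = 0 \<and> y = 0" if "\<i> * x = complex_of_real e * y" "\<i> * y = - complex_of_real e * x" for x y :: complex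
    proof -
      have "e * (e * y) = e * (\<i> * x)" using that by simp
      also have "\<dots> = - \<i> * (- complex_of_real e * x)" by simp
      also have "\<dots> = y" unfolding that(2)[symmetric] by simp
      finally have "(complex_of_real (e * e) - 1) * y = 0" by (simp add: algebra_simps)
      moreover have "complex_of_real (e * e) - 1 \<noteq> 0"
        using ne by (metis eq_iff_diff_eq_0 of_real_eq_1_iff)
      ultimately have "y = 0" by simp
      then show ?thesis using that by simp
    qed
    have "F = (\<lambda>\<alpha> \<beta>. 0)"
      using *[OF h(1,4)] *[OF h(2,5)] *[OF h(3,6)] by (intro antisym_ext[OF F]) auto
    then show False using assms(5) by (simp add: zero_fun_def)
  qed
  then show "\<eta> 0 1 2 3 * \<eta> 0 1 2 3 = 1" by (simp add: e_def)
qed (rule \<eta> refl)+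

lemma subspace_SD: "tensor2.subspace (SD g \<eta>)"
proof -
  have add: "hodge g \<eta> (F + H) = hodge g \<eta> F + hodge g \<eta> H" for F H
    by (simp add: fun_eq_iff hodge_def raise2_def sum.distrib algebra_simps)
  have scale: "hodge g \<eta> (scale2 c F) = scale2 c (hodge g \<eta> F)" for c F
    unfolding fun_eq_iff hodge_def raise2_def scale2_def sum_distrib_left
    by (intro allI sum.cong refl) (simp add: ac_simps)
  have zero: "hodge g \<eta> 0 = 0"
    by (simp add: fun_eq_iff hodge_def raise2_def)
  show ?thesis
    unfolding tensor2.subspace_def SD_def mem_Collect_eq
  proof (intro conjI ballI allI, unfold mem_Collect_eq add scale zero)
    fix c F \<alpha> \<beta> assume F: "(\<forall>\<alpha> \<beta>. F \<alpha> \<beta> = - F \<beta> \<alpha>) \<and> hodge g \<eta> F = scale2 \<i> F"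
    then have "F \<alpha> \<beta> = - F \<beta> \<alpha>" by blast
    then show "scale2 c F \<alpha> \<beta> = - scale2 c F \<beta> \<alpha>"
      by (simp add: scale2_def)
    show "scale2 c (hodge g \<eta> F) = scale2 \<i> (scale2 c F)"
      using F by (simp add: mult.commute)
  next
    fix F H \<alpha> \<beta> assume F: "(\<forall>\<alpha> \<beta>. F \<alpha> \<beta> = - F \<beta> \<alpha>) \<and> hodge g \<eta> F = scale2 \<i> F"
      and H: "(\<forall>\<alpha> \<beta>. H \<alpha> \<beta> = - H \<beta> \<alpha>) \<and> hodge g \<eta> H = scale2 \<i> H"
    then have "F \<alpha> \<beta> = - F \<beta> \<alpha>" "H \<alpha> \<beta> = - H \<beta> \<alpha>" by blast+
    then show "(F + H) \<alpha> \<beta> = - (F + H) \<beta> \<alpha>"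
      by simp
    show "hodge g \<eta> F + hodge g \<eta> H = scale2 \<i> (F + H)"
      using F H by (simp add: tensor2.scale_right_distrib)
  qed simp_all
qed

section \<open>Self-dual bivectors and the Weyl tensor in an arbitrary basis\<close>

locale weyl_tetrad = tetrad g P Q for g P Q +
  fixes \<eta> W :: "real tensor4" and e :: real
  assumes pulled: "minkowski_weyl (pull4 P \<eta>) e (pull4 P W)"
begin

sublocale mk: minkowski_weyl "pull4 P \<eta>" e "pull4 P W"
  by (rule pulled)

abbreviation X where "X \<equiv> sd_weyl g \<eta> W"

lemma X_pair: "X \<alpha> \<beta> \<mu> \<nu> = X \<mu> \<nu> \<alpha> \<beta>"
proof -
  have "pull4 P X = pull4 P (\<lambda>\<alpha> \<beta> \<mu> \<nu>. X \<mu> \<nu> \<alpha> \<beta>)"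
    unfolding fun_eq_iff pull4_swap(4)[of P X] unfolding pull4_sd_weyl using mk.sd_weyl_pair by blast
  then show ?thesis
    unfolding pull4_inject by meson
qed

text \<open>Only the first pair is pulled into the tetrad; the second is expanded along
  \<open>Q\<close>. This writes the tensor as a combination of tetrad slices, each self-dual by
  \<open>mk.sd_weyl_SD\<close>.\<close>

lemma X_SD: "(\<lambda>\<alpha> \<beta>. X \<alpha> \<beta> \<mu> \<nu>) \<in> SD g \<eta>"
proof -
  have "pull2 P (\<lambda>\<alpha> \<beta>. X \<alpha> \<beta> \<mu> \<nu>) a b = pull2 Q (pull4 P X a b) \<mu> \<nu>" for a b
    unfolding pull4_def pull2_inverse ..
  then have "pull2 P (\<lambda>\<alpha> \<beta>. X \<alpha> \<beta> \<mu> \<nu>)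
     = (\<Sum>c\<in>UNIV. \<Sum>d\<in>UNIV. scale2 (of_real (Q $ c $ \<mu> * Q $ d $ \<nu>)) (\<lambda>a b. sd_weyl minkowski (pull4 P \<eta>) (pull4 P W) a b c d))"
    by (simp add: fun_eq_iff pull4_sd_weyl scale2_def pull2_def sum_fun_apply)
  also have "\<dots> \<in> SD minkowski (pull4 P \<eta>)"
    by (intro tensor2.subspace_sum tensor2.subspace_scale subspace_SD mk.sd_weyl_SD)
  finally show ?thesis
    using SD_tetrad by blast
qed

lemma biv_trace_X: "biv_trace g X = 0"
proof -
  \<comment> \<open>\<open>biv_trace\<close> raises the second pair, whereas the inner
    \<open>pull2\<close> of \<open>pull4\<close> acts on the first; pair symmetry reconciles
    them.\<close>
  have 1: "pull2 P (X \<alpha> \<beta>) a b = pull2 P (\<lambda>\<mu> \<nu>. X \<mu> \<nu> \<alpha> \<beta>) a b" for \<alpha> \<beta> a b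
    by (rule arg_cong[where f = "\<lambda>F. pull2 P F a b"]) (intro ext X_pair)
  have "(\<Sum>\<alpha>\<in>UNIV. \<Sum>\<beta>\<in>UNIV. raise2 g (X \<alpha> \<beta>) \<alpha> \<beta>)
    = (\<Sum>a\<in>UNIV. \<Sum>b\<in>UNIV. \<Sum>\<alpha>\<in>UNIV. \<Sum>\<beta>\<in>UNIV. of_real (P $ \<alpha> $ a * P $ \<beta> $ b) *
        (of_real (lsign a * lsign b) * pull2 P (\<lambda>\<mu> \<nu>. X \<mu> \<nu> \<alpha> \<beta>) a b))"
    unfolding raise2_tetrad raise2_minkowski 1 by (rule sum_swap4)
  also have "\<dots> = (\<Sum>a\<in>UNIV. \<Sum>b\<in>UNIV. raise2 minkowski (pull4 P X a b) a b)"
    unfolding raise2_minkowski pull4_def pull2_def[of P _ a b for a b] sum_distrib_left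
    by (simp add: ac_simps)
  finally show ?thesis
    using mk.biv_trace_sd_weyl unfolding biv_trace_def pull4_sd_weyl by simp
qed

lemma dot2_cnj_sym_traceless:
  assumes "F \<in> SD g \<eta>" "K \<in> SD g \<eta>"
  shows "dot2 g F (\<lambda>\<alpha> \<beta>. cnj (K \<alpha> \<beta>)) \<in> sym_traceless g"
proof -
  define D where "D = dot2 g F (\<lambda>\<alpha> \<beta>. cnj (K \<alpha> \<beta>))"
  have D: "pull2 P D = dot2 minkowski (pull2 P F) (\<lambda>\<alpha> \<beta>. cnj (pull2 P K \<alpha> \<beta>))"
    unfolding D_def pull2_dot2 pull2_cnj ..
  note st = mk.dot2_cnj_sym_traceless[OF assms[unfolded SD_tetrad], folded D]
  have "pull2 P D = pull2 P (\<lambda>\<alpha> \<beta>. D \<beta> \<alpha>)"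
    unfolding fun_eq_iff using st(1) pull2_swap[of P D] by simp
  then have "D = (\<lambda>\<alpha> \<beta>. D \<beta> \<alpha>)"
    unfolding pull2_inject .
  then have "\<forall>\<alpha> \<beta>. D \<alpha> \<beta> = D \<beta> \<alpha>"
    by meson
  then show ?thesis
    using st(2) unfolding sym_traceless_def trace_tetrad mem_Collect_eq D_def[symmetric] by blast
qed

lemma dot2_cnj_inner:
  assumes "F \<in> SD g \<eta>" "K \<in> SD g \<eta>" "H \<in> SD g \<eta>" "L \<in> SD g \<eta>"
  shows "(\<Sum>\<alpha>\<in>UNIV. \<Sum>\<beta>\<in>UNIV. dot2 g F (\<lambda>\<alpha> \<beta>. cnj (K \<alpha> \<beta>)) \<alpha> \<beta> *
      raise2 g (dot2 g H (\<lambda>\<alpha> \<beta>. cnj (L \<alpha> \<beta>))) \<alpha> \<beta>) = biv_metric g F H * cnj (biv_metric g K L)"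
  unfolding contract_tetrad biv_metric_tetrad pull2_dot2 pull2_cnj
  by (rule mk.dot2_cnj_inner) (use assms SD_tetrad in blast)+

lemma sym_traceless_products:
  assumes "A \<in> sym_traceless g"
  shows "\<exists>B :: 3 \<Rightarrow> complex tensor2. \<exists>c. range B \<subseteq> SD g \<eta> \<and>
    A = (\<lambda>\<alpha> \<beta>. \<Sum>i\<in>UNIV. \<Sum>j\<in>UNIV. c i j * dot2 g (B i) (\<lambda>\<alpha> \<beta>. cnj (B j \<alpha> \<beta>)) \<alpha> \<beta>)"
proof -
  have sym: "A \<alpha> \<beta> = A \<beta> \<alpha>" for \<alpha> \<beta>
    using assms unfolding sym_traceless_def by blast
  have "(\<lambda>\<alpha> \<beta>. A \<beta> \<alpha>) = A"
    by (intro ext) (rule sym)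
  then have pull_sym: "pull2 P A \<alpha> \<beta> = pull2 P A \<beta> \<alpha>" for \<alpha> \<beta>
    using pull2_swap[of P A \<alpha> \<beta>] by (simp only:)
  have pull_trace: "(\<Sum>a\<in>UNIV. complex_of_real (lsign a) * pull2 P A a a) = 0"
    using assms unfolding sym_traceless_def trace_tetrad by blast
  obtain B c where B: "range B \<subseteq> SD minkowski (pull4 P \<eta>)" and
    A: "pull2 P A = (\<lambda>\<alpha> \<beta>. \<Sum>i\<in>UNIV. \<Sum>j\<in>UNIV. c i j * dot2 minkowski (B i) (\<lambda>\<alpha> \<beta>. cnj (B (j::3) \<alpha> \<beta>)) \<alpha> \<beta>)"
    using mk.sym_traceless_minkowski[of "pull2 P A", OF pull_sym pull_trace] by blast
  have D: "dot2 minkowski (B i) (\<lambda>\<alpha> \<beta>. cnj (B j \<alpha> \<beta>)) = pull2 P (dot2 g (pull2 Q (B i)) (\<lambda>\<alpha> \<beta>. cnj (pull2 Q (B j) \<alpha> \<beta>)))" for i j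
    unfolding pull2_dot2 pull2_cnj pull2_inverse ..
  have "pull2 P A = pull2 P (\<lambda>\<alpha> \<beta>. \<Sum>i\<in>UNIV. \<Sum>j\<in>UNIV. c i j * dot2 g (pull2 Q (B i)) (\<lambda>\<alpha> \<beta>. cnj (pull2 Q (B j) \<alpha> \<beta>)) \<alpha> \<beta>)"
    unfolding A D by (intro ext) (simp only: pull2_sum pull2_mult)
  then have "A = (\<lambda>\<alpha> \<beta>. \<Sum>i\<in>UNIV. \<Sum>j\<in>UNIV. c i j * dot2 g (pull2 Q (B i)) (\<lambda>\<alpha> \<beta>. cnj (pull2 Q (B j) \<alpha> \<beta>)) \<alpha> \<beta>)"
    unfolding pull2_inject .
  moreover have "range (\<lambda>i. pull2 Q (B i)) \<subseteq> SD g \<eta>"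
  proof -
    have "pull2 P (pull2 Q (B i)) \<in> SD minkowski (pull4 P \<eta>)" for i
      unfolding pull2_inverse using B by auto
    then show ?thesis
      unfolding SD_tetrad[symmetric] by auto
  qed
  ultimately show ?thesis
    by (intro exI[of _ "\<lambda>i. pull2 Q (B i)"] exI[of _ c] conjI)
qed

end

text \<open>\<open>F\<close> is the witness for \<open>SD_minkowski_volume\<close>: it stays nonzero
  in the tetrad because \<open>pull2\<close> is injective, and so fixes the tetrad component of
  \<open>\<eta>\<close> up to sign.\<close>

lemma weyl_tetrad_exists:
  assumes "lorentzian g" "volume_element g \<eta>" "weyl_tensor g W" "F \<in> SD g \<eta>" "F \<noteq> 0"
  obtains P Q e where "weyl_tetrad g P Q \<eta> W e"
proof -
  obtain P Q where "tetrad g P Q"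
    using lorentzian_tetrad[OF assms(1)] tetrad_def by metis
  then interpret tetrad g P Q .
  have \<eta>: "\<eta> \<alpha> \<beta> \<mu> \<nu> = - \<eta> \<beta> \<alpha> \<mu> \<nu>" "\<eta> \<alpha> \<beta> \<mu> \<nu> = - \<eta> \<alpha> \<mu> \<beta> \<nu>" "\<eta> \<alpha> \<beta> \<mu> \<nu> = - \<eta> \<alpha> \<beta> \<nu> \<mu>" for \<alpha> \<beta> \<mu> \<nu>
    using assms(2) unfolding volume_element_def by blast+
  have W: "W \<alpha> \<beta> \<mu> \<nu> = - W \<beta> \<alpha> \<mu> \<nu>" "W \<alpha> \<beta> \<mu> \<nu> = - W \<alpha> \<beta> \<nu> \<mu>" "W \<alpha> \<beta> \<mu> \<nu> = W \<mu> \<nu> \<alpha> \<beta>"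
    "W \<alpha> \<beta> \<mu> \<nu> + W \<alpha> \<mu> \<nu> \<beta> + W \<alpha> \<nu> \<beta> \<mu> = 0" for \<alpha> \<beta> \<mu> \<nu>
    using assms(3) unfolding weyl_tensor_def by blast+
  have W_tr: "(\<Sum>\<alpha>\<in>UNIV. \<Sum>\<mu>\<in>UNIV. matrix_inv g $ \<alpha> $ \<mu> * W \<alpha> \<beta> \<mu> \<nu>) = 0" for \<beta> \<nu>
    using assms(3) unfolding weyl_tensor_def by blast
  have "pull2 P (0 :: complex tensor2) = 0"
    by (simp add: fun_eq_iff pull2_def)
  then have "pull2 P F \<noteq> 0"
    using assms(5) pull2_inject[of F 0] by simp
  then have "minkowski_volume (pull4 P \<eta>) (pull4 P \<eta> 0 1 2 3)"
    by (intro SD_minkowski_volume[of _ "pull2 P F"] pull4_antisym pull4_antisym_middle pull4_antisym_right \<eta>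
      assms(4)[unfolded SD_tetrad])
  then have "minkowski_weyl (pull4 P \<eta>) (pull4 P \<eta> 0 1 2 3) (pull4 P W)"
    unfolding minkowski_weyl_def minkowski_weyl_axioms_def
    by (intro conjI allI pull4_antisym pull4_antisym_right pull4_pair pull4_Bianchi pull4_trace W W_tr)
  then show thesis
    using that \<open>tetrad g P Q\<close> by (metis weyl_tetrad_axioms_def weyl_tetrad_def)
qed

section \<open>Diagonalizable maps and real cubics\<close>

text \<open>Diagonalization with coordinate functionals defined on all tensors. As
  \<open>T_eq\<close> is also asked for everywhere, coordinates of iterates of T - c can be followed
  without checking that these stay in \<open>V\<close>.\<close>

locale diagonal_map =
  fixes V :: "complex tensor2 set" and T :: "complex tensor2 \<Rightarrow> complex tensor2"
    and v :: "'i::finite \<Rightarrow> complex tensor2" and co :: "'i \<Rightarrow> complex tensor2 \<Rightarrow> complex" and l :: "'i \<Rightarrow> complex"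
  assumes subspace_V: "tensor2.subspace V" and v_V: "v i \<in> V"
    and co_add: "co i (A + B) = co i A + co i B" and co_scale: "co i (scale2 c A) = c * co i A"
    and co_v: "co i (v j) = (if i = j then 1 else 0)"
    and expansion: "A \<in> V \<Longrightarrow> A = (\<Sum>i\<in>UNIV. scale2 (co i A) (v i))"
    and T_eq: "T A = (\<Sum>i\<in>UNIV. scale2 (l i * co i A) (v i))"
begin

lemma co_zero: "co i 0 = 0"
  using co_add[of i 0 0] unfolding add_0 by simp

lemma co_sum: "co i (\<Sum>j\<in>J. f j) = (\<Sum>j\<in>J. co i (f j))"
  by (induction J rule: infinite_finite_induct)
    (simp_all only: sum.infinite sum.empty sum.insert co_zero co_add if_False not_False_eq_True)

lemma co_T: "co i (T A) = l i * co i A"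
  unfolding T_eq co_sum co_scale co_v by (simp add: if_distrib[where f = "\<lambda>x. _ * x"] cong: if_cong)

lemma inj_v: "inj v"
  using co_v by (metis injI zero_neq_one)

lemma independent_v: "tensor2.independent (range v)"
proof
  assume "tensor2.dependent (range v)"
  then obtain u i where ui: "u (v i) \<noteq> 0" and 0: "(\<Sum>x\<in>range v. scale2 (u x) x) = 0"
    unfolding tensor2.dependent_finite[OF finite_imageI[OF finite]] by blast
  have "co i (\<Sum>x\<in>range v. scale2 (u x) x) = u (v i)"
    unfolding sum.reindex[OF inj_v] co_sum o_def co_scale co_v by (simp add: if_distrib[where f = "\<lambda>x. _ * x"] cong: if_cong)
  then show False
    using ui 0 co_zero by simp
qed

lemma dim_span_v: "tensor2.dim (tensor2.span (v ` J)) = card J"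
proof -
  have "tensor2.independent (v ` J)"
    using independent_v by (rule tensor2.independent_mono) blast
  then have "tensor2.dim (tensor2.span (v ` J)) = card (v ` J)"
    by (simp add: tensor2.dim_eq_card_independent)
  then show ?thesis
    using inj_v by (metis card_image inj_on_subset subset_UNIV)
qed

lemma co_diff: "co i (A - B) = co i A - co i B"
  using co_add[of i "A - B" B] unfolding diff_add_cancel by simp

lemma span_eigenvectors: "tensor2.span (v ` {i. l i = c}) \<subseteq> {A \<in> V. T A = scale2 c A}"
proof (rule tensor2.span_minimal)
  have "T (v j) = scale2 (l j) (v j)" for j
  proof -
    have "T (v j) = (\<Sum>i\<in>UNIV. if i = j then scale2 (l j) (v j) else 0)"
      unfolding T_eq co_v by (intro sum.cong refl) auto
    then show ?thesis by simp
  qed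
  then show "v ` {i. l i = c} \<subseteq> {A \<in> V. T A = scale2 c A}"
    using v_V by auto
  have "T 0 = 0"
    unfolding T_eq co_zero by simp
  moreover have "T (A + B) = T A + T B" for A B
    unfolding T_eq co_add by (simp add: distrib_left tensor2.scale_left_distrib sum.distrib)
  moreover have "T (scale2 d A) = scale2 d (T A)" for d A
    unfolding T_eq co_scale by (simp add: tensor2.scale_sum_right ac_simps)
  ultimately show "tensor2.subspace {A \<in> V. T A = scale2 c A}"
    using subspace_V unfolding tensor2.subspace_def
    by (simp add: tensor2.scale_right_distrib mult.commute)
qed

text \<open>In coordinates the n-th power of T - c multiplies by (l_i - c)^n, so annihilation by it
  kills every coordinate with l_i different from c. Algebraic and geometric multiplicities therefore
  agree.\<close>

lemma generalized_eigenspace: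
  "{A \<in> V. \<exists>n. ((\<lambda>B. T B - scale2 c B) ^^ n) A = 0} = tensor2.span (v ` {i. l i = c})"
proof
  show "{A \<in> V. \<exists>n. ((\<lambda>B. T B - scale2 c B) ^^ n) A = 0} \<subseteq> tensor2.span (v ` {i. l i = c})"
  proof safe
    fix A n assume A: "A \<in> V" and 0: "((\<lambda>B. T B - scale2 c B) ^^ n) A = 0"
    have "co i (((\<lambda>B. T B - scale2 c B) ^^ n) A) = (l i - c) ^ n * co i A" for i
    proof (induction n)
      case (Suc n)
      show ?case
        unfolding funpow.simps o_apply co_diff co_T co_scale Suc by (simp add: algebra_simps)
    qed simp
    then have "co i A = 0" if "l i \<noteq> c" for i
      using that unfolding 0 co_zero by (metis mult_eq_0_iff power_not_zero right_minus_eq)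
    then have "A = (\<Sum>i\<in>{i. l i = c}. scale2 (co i A) (v i))"
      by (subst expansion[OF A], intro sum.mono_neutral_right) auto
    also have "\<dots> \<in> tensor2.span (v ` {i. l i = c})"
      by (intro tensor2.span_sum tensor2.span_scale tensor2.span_base) auto
    finally show "A \<in> tensor2.span (v ` {i. l i = c})" .
  qed
  show "tensor2.span (v ` {i. l i = c}) \<subseteq> {A \<in> V. \<exists>n. ((\<lambda>B. T B - scale2 c B) ^^ n) A = 0}"
  proof
    fix A assume "A \<in> tensor2.span (v ` {i. l i = c})"
    then have "A \<in> V" "T A = scale2 c A"
      using span_eigenvectors by auto
    then have "A \<in> V" "((\<lambda>B. T B - scale2 c B) ^^ 1) A = 0"
      by simp_all
    then show "A \<in> {A \<in> V. \<exists>n. ((\<lambda>B. T B - scale2 c B) ^^ n) A = 0}"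
      by blast
  qed
qed

lemma eigenspace_span: "{A \<in> V. T A = scale2 c A} = tensor2.span (v ` {i. l i = c})"
proof
  have "((\<lambda>B. T B - scale2 c B) ^^ 1) A = 0" if "T A = scale2 c A" for A
    using that by simp
  then show "{A \<in> V. T A = scale2 c A} \<subseteq> tensor2.span (v ` {i. l i = c})"
    unfolding generalized_eigenspace[symmetric] by blast
qed (rule span_eigenvectors)

end

section \<open>Real roots of a cubic and products in zero-sum triples\<close>

lemma cubic_root_real:
  fixes x y z :: complex and m :: real
  assumes s: "x + y + z = 0" and s2: "x^2 + y^2 + z^2 = m" and s3: "x^3 + y^3 + z^3 = m" and m: "m > 6"
  shows "x \<in> \<real>" and "x \<noteq> 0" and "x \<noteq> y"
proof -
  have z: "z = - x - y" using s by algebra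
  \<comment> \<open>Newton's identities: the elementary symmetric functions are 0, -m/2 and m/3, so
    the discriminant -4 e2^3 - 27 e3^2 is m^2 (m - 6) / 2.\<close>
  have e2: "x * y + x * z + y * z = - m / 2"
    using s2 unfolding z by (simp add: power2_eq_square field_simps)
  have e3: "x * y * z = m / 3"
    using s3 unfolding z by (simp add: power3_eq_cube field_simps)
  have disc: "((x - y) * (y - z) * (z - x))^2 = complex_of_real (m^2 * (m - 6) / 2)"
  proof -
    have "((x - y) * (y - z) * (z - x))^2 = - 4 * (x * y + x * z + y * z)^3 - 27 * (x * y * z)^2"
      unfolding z by algebra
    then show ?thesis
      unfolding e2 e3 by (simp add: power2_eq_square power3_eq_cube field_simps)
  qed
  have pos: "m^2 * (m - 6) / 2 > 0"
    using m by simp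
  then have "((x - y) * (y - z) * (z - x))^2 \<noteq> 0"
    unfolding disc by (metis of_real_eq_0_iff less_irrefl)
  then show "x \<noteq> y" by auto
  show "x \<noteq> 0" using e3 m by auto
  have cubic: "(w - x) * (w - y) * (w - z) = w^3 - (m / 2) * w - m / 3" for w :: complex
  proof -
    have "(w - x) * (w - y) * (w - z) = w^3 - (x + y + z) * w^2 + (x * y + x * z + y * z) * w - x * y * z"
      by algebra
    then show ?thesis
      unfolding s e2 e3 by simp
  qed
  have "x^3 - (m / 2) * x - m / 3 = 0"
    unfolding cubic[symmetric] by simp
  then have "cnj (x^3 - (m / 2) * x - m / 3) = 0"
    by (simp only: complex_cnj_zero)
  then have "(cnj x)^3 - (m / 2) * cnj x - m / 3 = 0"
    by (simp only: complex_cnj_diff complex_cnj_mult complex_cnj_power complex_cnj_complex_of_real)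
  then have roots: "cnj x = x \<or> cnj x = y \<or> cnj x = z"
    unfolding cubic[symmetric] by simp
  \<comment> \<open>Two conjugate nonreal roots would make the discriminant negative.\<close>
  have contra: False
    if w: "cnj x = w" "w \<noteq> x" and t: "x + w + t = 0" and d: "((x - w) * (w - t) * (t - x))^2 = complex_of_real (m^2 * (m - 6) / 2)" for w t
  proof -
    have im: "x - w = 2 * \<i> * Im x"
      using w(1) complex_eq_iff by force
    \<comment> \<open>The third root is real, being minus a sum of conjugates. Thus (w - t)(t - x)
      is minus a squared modulus while x - w is imaginary, and the square is at most zero.\<close>
    have "t = - (x + cnj x)" using t w(1) by (metis add_eq_0_iff2 add.commute)
    then have "cnj t = t" by simp
    then have "(w - t) * (t - x) = - ((x - t) * cnj (x - t))"
      using w(1) by (simp add: algebra_simps)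
    also have "\<dots> = - complex_of_real ((cmod (x - t))^2)"
      by (simp only: complex_norm_square)
    finally have "((x - w) * (w - t) * (t - x))^2 = (2 * \<i> * Im x * (- complex_of_real ((cmod (x - t))^2)))^2"
      unfolding im by (simp add: mult.assoc)
    also have "\<dots> = complex_of_real (- ((2 * Im x * (cmod (x - t))^2)^2))"
      by (simp add: power_mult_distrib)
    finally have "m^2 * (m - 6) / 2 = - ((2 * Im x * (cmod (x - t))^2)^2)"
      unfolding d using of_real_eq_iff by blast
    then show False
      using pos by (metis less_le_not_le neg_le_0_iff_le zero_le_power2)
  qed
  have "cnj x = x"
  proof (rule ccontr)
    assume n: "cnj x \<noteq> x"
    then consider "cnj x = y" | "cnj x = z" using roots by blast
    then show False
    proof cases
      case 1
      then show False using contra[of y z] n s disc by metis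
    next
      case 2
      \<comment> \<open>Exchanging y and z only changes the sign of the product, so the square is
        still the discriminant.\<close>
      have "((x - z) * (z - y) * (y - x))^2 = ((x - y) * (y - z) * (z - x))^2"
        by algebra
      then show False using contra[of z y] n s disc 2 by (metis add.assoc add.commute)
    qed
  qed
  then show "x \<in> \<real>"
    using Reals_cnj_iff by blast
qed

text \<open>Two squares differ because y_a - y_b and y_a + y_b = -y_c are nonzero. A square and the
  product of the other two numbers differ by the definite form y_b^2 + y_b y_c + y_c^2; this needs
  reality, as the complex cube roots of unity show. In the remaining cases a common nonzero factor
  cancels.\<close>

lemma zero_sum_products:
  fixes y :: "3 \<Rightarrow> real"
  assumes s: "(\<Sum>i\<in>UNIV. y i) = 0" and ne: "\<And>i. y i \<noteq> 0" and d: "inj y"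
  shows "y j * y k = y i * y i \<longleftrightarrow> j = i \<and> k = i"
    and "y j * y k = y (i + 1) * y (i + 2) \<longleftrightarrow> (j = i + 1 \<and> k = i + 2) \<or> (j = i + 2 \<and> k = i + 1)"
proof -
  have sq: "y a * y a \<noteq> y b * y b" "y a * y a \<noteq> y b * y c"
    if "y a + y b + y c = 0" "a \<noteq> b" for a b c
  proof -
    have "y a - y b \<noteq> 0" using d that(2) by (simp add: inj_eq)
    moreover have "y a + y b \<noteq> 0" using that(1) ne[of c] by linarith
    moreover have "y a * y a - y b * y b = (y a - y b) * (y a + y b)" by algebra
    ultimately show "y a * y a \<noteq> y b * y b" by (metis mult_eq_0_iff right_minus_eq)
    have ya: "y a = - (y b + y c)" using that(1) by linarith
    have "y a * y a - y b * y c = (y b + y c / 2)^2 + 3 / 4 * (y c)^2"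
      unfolding ya by (simp add: power2_eq_square algebra_simps)
    moreover have "\<dots> > 0"
      using ne[of c] by (intro add_nonneg_pos) simp_all
    ultimately show "y a * y a \<noteq> y b * y c" by linarith
  qed
  have s': "y 1 + y 2 + y 3 = 0" using s by (simp add: sum_3)
  have sqs: "y 1 * y 1 \<noteq> y 2 * y 2" "y 1 * y 1 \<noteq> y 3 * y 3" "y 2 * y 2 \<noteq> y 3 * y 3"
    "y 1 * y 1 \<noteq> y 2 * y 3" "y 2 * y 2 \<noteq> y 1 * y 3" "y 3 * y 3 \<noteq> y 1 * y 2"
    using s' by (intro sq[of 1 2 3] sq[of 1 3 2] sq[of 2 3 1] sq[of 2 1 3] sq[of 3 1 2]; simp)+
  have ys: "y 1 \<noteq> y 2" "y 1 \<noteq> y 3" "y 2 \<noteq> y 3"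
    using d by (simp_all add: inj_eq)
  have n: "y 1 \<noteq> 0" "y 2 \<noteq> 0" "y 3 \<noteq> 0" by (rule ne)+
  \<comment> \<open>Indices i + 1 and i + 2 run modulo 3, so the literals 4 and 5 arise and stand
    for 1 and 2.\<close>
  have num: "(4::3) = 1" "(5::3) = 2" by simp_all
  note facts = sqs sqs[symmetric] ys ys[symmetric] n
  have "\<forall>i j k. y j * y k = y i * y i \<longleftrightarrow> j = i \<and> k = i"
    unfolding forall_3 using facts by (simp add: mult.commute)
  then show "y j * y k = y i * y i \<longleftrightarrow> j = i \<and> k = i" by blast
  have "\<forall>i j k. y j * y k = y (i + 1) * y (i + 2) \<longleftrightarrow> (j = i + 1 \<and> k = i + 2) \<or> (j = i + 2 \<and> k = i + 1)"
    unfolding forall_3 using facts by (simp add: mult.commute num)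
  then show "y j * y k = y (i + 1) * y (i + 2) \<longleftrightarrow> (j = i + 1 \<and> k = i + 2) \<or> (j = i + 2 \<and> k = i + 1)" by blast
qed

section \<open>Canonical form of the Bel-Robinson tensor\<close>

lemma sum_swap3_last:
  "(\<Sum>\<rho>\<in>A. \<Sum>\<sigma>\<in>B. \<Sum>a\<in>C. f \<rho> \<sigma> a) = (\<Sum>a\<in>C. \<Sum>\<rho>\<in>A. \<Sum>\<sigma>\<in>B. f \<rho> \<sigma> a)"
  by (rule trans[OF sum_swap3], rule sum.cong[OF refl], rule sum.swap)

lemma raise2_add: "raise2 g (F + H) \<mu> \<nu> = raise2 g F \<mu> \<nu> + raise2 g H \<mu> \<nu>"
  unfolding raise2_def by (simp add: sum.distrib distrib_left)

lemma raise2_mult: "raise2 g (\<lambda>\<alpha> \<beta>. c * F \<alpha> \<beta>) \<mu> \<nu> = c * raise2 g F \<mu> \<nu>"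
  unfolding raise2_def by (simp add: sum_distrib_left ac_simps)

lemma raise2_minus: "raise2 g (\<lambda>\<alpha> \<beta>. - F \<alpha> \<beta>) \<mu> \<nu> = - raise2 g F \<mu> \<nu>"
  unfolding raise2_def by (simp add: sum_negf)

lemma raise2_sum: "raise2 g (\<lambda>\<alpha> \<beta>. \<Sum>i\<in>I. F i \<alpha> \<beta>) \<mu> \<nu> = (\<Sum>i\<in>I. raise2 g (F i) \<mu> \<nu>)"
  unfolding raise2_def sum_distrib_left by (rule sum_swap3_last)

text \<open>One bilinear form for two uses: half of it is the metric on bivectors, and on symmetric
  tensors it makes the products \<open>Pi2\<close> orthonormal.\<close>

definition contract2 :: "metric \<Rightarrow> complex tensor2 \<Rightarrow> complex tensor2 \<Rightarrow> complex" where
  "contract2 g A B = (\<Sum>\<alpha>\<in>UNIV. \<Sum>\<beta>\<in>UNIV. A \<alpha> \<beta> * raise2 g B \<alpha> \<beta>)"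

lemma contract2_add: "contract2 g A (B + C) = contract2 g A B + contract2 g A C"
  unfolding contract2_def raise2_add by (simp add: sum.distrib distrib_left)

lemma contract2_scale2: "contract2 g A (scale2 c B) = c * contract2 g A B"
  unfolding contract2_def scale2_def raise2_mult by (simp add: sum_distrib_left ac_simps)

lemma contract2_scale2_left: "contract2 g (scale2 c A) B = c * contract2 g A B"
  unfolding contract2_def scale2_def by (simp add: sum_distrib_left ac_simps)

lemma contract2_sum_left: "contract2 g (\<lambda>\<alpha> \<beta>. \<Sum>i\<in>I. F i \<alpha> \<beta>) B = (\<Sum>i\<in>I. contract2 g (F i) B)"
  unfolding contract2_def sum_distrib_right by (rule sum_swap3_last)

lemma biv_metric_contract2: "biv_metric g F H = (1/2) * contract2 g F H"
  unfolding biv_metric_def contract2_def ..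

lemma biv_act_contract2: "biv_act g Y F \<alpha> \<beta> = (1/2) * contract2 g (Y \<alpha> \<beta>) F"
  unfolding biv_act_def contract2_def ..

lemma tensor_act_contract2: "tensor_act g Y A \<alpha> \<beta> = contract2 g (Y \<alpha> \<beta>) A"
  unfolding tensor_act_def contract2_def ..

lemma (in tetrad) contract2_commute: "contract2 g A B = contract2 g B A"
  unfolding contract2_def contract_tetrad raise2_minkowski by (simp add: ac_simps)

text \<open>Both tensors factor over the two indices, hence so does their contraction. In the
  Bel-Robinson tensor each factor becomes a product of an eigenbivector with a conjugate
  one.\<close>

lemma (in tetrad) sum_raise2_rank_one:
  "(\<Sum>\<rho>\<in>UNIV. \<Sum>\<sigma>\<in>UNIV. raise2 g (\<lambda>\<rho> \<sigma>. u \<rho> * v \<sigma>) \<rho> \<sigma> * (w \<rho> * z \<sigma>))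
    = (\<Sum>\<rho>\<in>UNIV. \<Sum>\<rho>'\<in>UNIV. of_real (matrix_inv g $ \<rho> $ \<rho>') * u \<rho>' * w \<rho>) *
      (\<Sum>\<sigma>\<in>UNIV. \<Sum>\<sigma>'\<in>UNIV. of_real (matrix_inv g $ \<sigma> $ \<sigma>') * v \<sigma>' * z \<sigma>)"
proof -
  have "raise2 g (\<lambda>\<rho> \<sigma>. u \<rho> * v \<sigma>) \<rho> \<sigma> * (w \<rho> * z \<sigma>)
    = (\<Sum>\<rho>'\<in>UNIV. of_real (matrix_inv g $ \<rho> $ \<rho>') * u \<rho>' * w \<rho>) *
      (\<Sum>\<sigma>'\<in>UNIV. of_real (matrix_inv g $ \<sigma> $ \<sigma>') * v \<sigma>' * z \<sigma>)" for \<rho> \<sigma>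
    unfolding raise2_def sum_product unfolding sum_distrib_right
    by (intro sum.cong refl) (simp add: ac_simps)
  then show ?thesis
    by (simp only: sum_product[symmetric])
qed

section \<open>Expansion of the Weyl tensor in the frame of eigenbivectors\<close>

locale weyl_frame = weyl_tetrad g P Q \<eta> W e for g P Q \<eta> W e +
  fixes U :: "3 \<Rightarrow> complex tensor2" and \<rho> :: "3 \<Rightarrow> complex"
  assumes frame: "SD_orthonormal_frame g \<eta> U"
    and eigen: "biv_act g (sd_weyl g \<eta> W) (U i) = scale2 (\<rho> i) (U i)"
begin

lemma span_U: "tensor2.span (range U) = SD g \<eta>"
  using frame unfolding SD_orthonormal_frame_def by blast

lemma U_SD: "U i \<in> SD g \<eta>"
  unfolding span_U[symmetric] by (rule tensor2.span_base) simp

lemma biv_metric_U: "biv_metric g (U i) (U j) = (if i = j then -1 else 0)"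
  using frame unfolding SD_orthonormal_frame_def by blast

lemma contract2_U: "contract2 g (U i) (U j) = (if i = j then -2 else 0)"
  using biv_metric_U[of i j] unfolding biv_metric_contract2 by (auto split: if_splits)

lemma U_antisym: "U i \<alpha> \<beta> = - U i \<beta> \<alpha>"
  using U_SD unfolding SD_def by blast

text \<open>The expansion holds on each \<open>v j\<close>, and both sides are linear. The common
  norm \<open>c\<close> is a parameter: -2 for \<open>U\<close> and 1 for
  \<open>Pi2\<close>.\<close>

lemma span_orthogonal_expansion:
  fixes v :: "'i::finite \<Rightarrow> complex tensor2"
  assumes v: "\<And>i j. contract2 g (v i) (v j) = (if i = j then c else 0)" and c: "c \<noteq> 0"
    and A: "A \<in> tensor2.span (range v)"
  shows "A = (\<Sum>i\<in>UNIV. scale2 (contract2 g (v i) A / c) (v i))"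
  using A
proof (induction rule: tensor2.span_induct_alt)
  case base
  have "contract2 g (v i) 0 = 0" for i
    using contract2_add[of g "v i" 0 0] unfolding add_0 by simp
  then show ?case
    by (simp only: div_0 tensor2.scale_zero_left sum.neutral_const)
next
  case (step d x A)
  then obtain j where x: "x = v j" by blast
  have "x = (\<Sum>i\<in>UNIV. if i = j then v j else 0)"
    unfolding x by simp
  also have "\<dots> = (\<Sum>i\<in>UNIV. scale2 (contract2 g (v i) x / c) (v i))"
    unfolding x v using c by (intro sum.cong refl) auto
  finally have x: "x = (\<Sum>i\<in>UNIV. scale2 (contract2 g (v i) x / c) (v i))" .
  show ?case
    by (subst x, subst step(2))
      (simp only: contract2_add contract2_scale2 add_divide_distrib tensor2.scale_left_distrib sum.distrib
        tensor2.scale_sum_right tensor2.scale_scale times_divide_eq_right)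
qed

lemma SD_expansion:
  assumes "F \<in> SD g \<eta>"
  shows "F \<alpha> \<beta> = (\<Sum>i\<in>UNIV. (- contract2 g (U i) F / 2) * U i \<alpha> \<beta>)"
proof -
  have "F = (\<Sum>i\<in>UNIV. scale2 (contract2 g (U i) F / (-2)) (U i))"
    by (rule span_orthogonal_expansion) (simp_all only: contract2_U span_U assms, simp_all)
  then have "F \<alpha> \<beta> = (\<Sum>i\<in>UNIV. scale2 (contract2 g (U i) F / (-2)) (U i)) \<alpha> \<beta>"
    by (rule arg_cong)
  then show ?thesis
    by (simp add: sum_fun_apply scale2_def)
qed

text \<open>With its second pair fixed, \<open>X\<close> is self-dual and expands in
  \<open>U\<close>. Pair symmetry turns the coefficient at \<open>U i\<close> into the action of
  \<open>X\<close> on \<open>U i\<close>, where the eigenvalue equation applies.\<close>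

lemma X_U: "X \<alpha> \<beta> \<mu> \<nu> = - (\<Sum>i\<in>UNIV. \<rho> i * (U i \<alpha> \<beta> * U i \<mu> \<nu>))"
proof -
  have "contract2 g (U i) (\<lambda>\<alpha> \<beta>. X \<alpha> \<beta> \<mu> \<nu>) = 2 * (\<rho> i * U i \<mu> \<nu>)" for i
  proof -
    have "(\<lambda>\<alpha> \<beta>. X \<alpha> \<beta> \<mu> \<nu>) = X \<mu> \<nu>"
      by (intro ext X_pair)
    then have "contract2 g (U i) (\<lambda>\<alpha> \<beta>. X \<alpha> \<beta> \<mu> \<nu>) = contract2 g (X \<mu> \<nu>) (U i)"
      using contract2_commute by metis
    also have "\<dots> = 2 * biv_act g X (U i) \<mu> \<nu>"
      unfolding biv_act_contract2 by simp
    finally show ?thesis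
      unfolding eigen scale2_def .
  qed
  then show ?thesis
    using SD_expansion[of "\<lambda>\<alpha> \<beta>. X \<alpha> \<beta> \<mu> \<nu>" \<alpha> \<beta>, OF X_SD] by (simp add: sum_negf ac_simps)
qed

text \<open>The sign compensates G(U_i, U_i) = -1, so that \<open>diag s\<close> has eigenvalue s_i
  on \<open>U i\<close>.\<close>

definition diag :: "(3 \<Rightarrow> complex) \<Rightarrow> complex tensor4" where
  "diag s = (\<lambda>\<alpha> \<beta> \<mu> \<nu>. \<Sum>i\<in>UNIV. - s i * U i \<mu> \<nu> * U i \<alpha> \<beta>)"

lemma X_diag: "X = diag \<rho>"
  unfolding diag_def fun_eq_iff X_U by (simp add: sum_negf ac_simps)

lemma biv_comp_diag: "biv_comp g X (diag s) = diag (\<lambda>i. \<rho> i * s i)"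
proof (intro ext)
  fix \<alpha> \<beta> \<mu> \<nu>
  have "biv_comp g X (diag s) \<alpha> \<beta> \<mu> \<nu> = (\<Sum>i\<in>UNIV. (- s i * U i \<mu> \<nu>) * biv_act g X (U i) \<alpha> \<beta>)"
    unfolding biv_comp_def diag_def biv_act_def raise2_sum raise2_mult sum_distrib_left
    by (subst sum_swap3_last) (intro sum.cong refl, simp)
  then show "biv_comp g X (diag s) \<alpha> \<beta> \<mu> \<nu> = diag (\<lambda>i. \<rho> i * s i) \<alpha> \<beta> \<mu> \<nu>"
    unfolding eigen scale2_def diag_def by (simp add: ac_simps)
qed

lemma biv_trace_diag: "biv_trace g (diag s) = (\<Sum>i\<in>UNIV. s i)"
proof -
  have "raise2 g (diag s \<alpha> \<beta>) \<mu> \<nu> = (\<Sum>i\<in>UNIV. - s i * (U i \<alpha> \<beta> * raise2 g (U i) \<mu> \<nu>))" for \<alpha> \<beta> \<mu> \<nu>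
  proof -
    have "diag s \<alpha> \<beta> = (\<lambda>\<mu> \<nu>. \<Sum>i\<in>UNIV. (- s i * U i \<alpha> \<beta>) * U i \<mu> \<nu>)"
      unfolding diag_def by (simp add: ac_simps)
    then show ?thesis
      by (simp only: raise2_sum raise2_mult mult.assoc)
  qed
  then have "biv_trace g (diag s) = (1/2) * (\<Sum>\<alpha>\<in>UNIV. \<Sum>\<beta>\<in>UNIV. \<Sum>i\<in>UNIV. - s i * (U i \<alpha> \<beta> * raise2 g (U i) \<alpha> \<beta>))"
    unfolding biv_trace_def by (simp only:)
  also have "\<dots> = (1/2) * (\<Sum>i\<in>UNIV. - s i * contract2 g (U i) (U i))"
    unfolding contract2_def sum_distrib_left[of "- s _"] by (rule arg_cong[OF sum_swap3_last])
  finally show ?thesis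
    unfolding contract2_U by (simp add: sum_distrib_left)
qed

text \<open>Powers of \<open>X\<close> stay diagonal and \<open>biv_trace\<close> adds up the
  entries; the first sum vanishes by \<open>biv_trace_X\<close>.\<close>

lemma sum_eigenvalues:
  "(\<Sum>i\<in>UNIV. \<rho> i) = 0" "weyl_a g \<eta> W = (\<Sum>i\<in>UNIV. \<rho> i ^ 2)" "weyl_b g \<eta> W = (\<Sum>i\<in>UNIV. \<rho> i ^ 3)"
proof -
  have sq: "biv_comp g X X = diag (\<lambda>i. \<rho> i * \<rho> i)"
    using biv_comp_diag[of \<rho>] unfolding X_diag[symmetric] .
  show "(\<Sum>i\<in>UNIV. \<rho> i) = 0"
    using biv_trace_X unfolding biv_trace_diag[symmetric] X_diag .
  show "weyl_a g \<eta> W = (\<Sum>i\<in>UNIV. \<rho> i ^ 2)"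
    unfolding weyl_a_def Let_def sq biv_trace_diag power2_eq_square ..
  show "weyl_b g \<eta> W = (\<Sum>i\<in>UNIV. \<rho> i ^ 3)"
    unfolding weyl_b_def Let_def sq biv_comp_diag biv_trace_diag power3_eq_cube by (simp add: ac_simps)
qed

section \<open>The nine products as an orthonormal eigenbasis\<close>

abbreviation Pi2 :: "3 \<times> 3 \<Rightarrow> complex tensor2" where
  "Pi2 p \<equiv> frame_prod g U (fst p) (snd p)"

lemma contract2_Pi2: "contract2 g (Pi2 p) (Pi2 q) = (if p = q then 1 else 0)"
  unfolding contract2_def frame_prod_def
  by (subst dot2_cnj_inner[OF U_SD U_SD U_SD U_SD]) (auto simp: biv_metric_U prod_eq_iff)

lemma Pi2_sym_traceless: "Pi2 p \<in> sym_traceless g"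
  unfolding frame_prod_def by (rule dot2_cnj_sym_traceless[OF U_SD U_SD])

text \<open>Both factors of \<open>T\<close> are expanded by \<open>X_U\<close>, and their minus
  signs cancel. For each (i, j) the sum splits by \<open>sum_raise2_rank_one\<close> into two
  factors, each minus a \<open>Pi2\<close> component: antisymmetry of \<open>U j\<close> is used
  once to reach the index order of \<open>dot2\<close>. These signs cancel too.\<close>

lemma bel_robinson_Pi2:
  "bel_robinson g \<eta> W \<alpha> \<mu> \<beta> \<nu> = (\<Sum>i\<in>UNIV. \<Sum>j\<in>UNIV. \<rho> i * cnj (\<rho> j) * (Pi2 (i, j) \<alpha> \<mu> * Pi2 (i, j) \<beta> \<nu>))"
proof -
  have Pi2: "(\<Sum>r\<in>UNIV. \<Sum>s\<in>UNIV. of_real (matrix_inv g $ r $ s) * U i \<alpha> s * cnj (U j \<mu> r)) = - Pi2 (i, j) \<alpha> \<mu>" for i j \<alpha> \<mu>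
  proof -
    have sym: "matrix_inv g $ r $ s = matrix_inv g $ s $ r" for r s
      unfolding ginv_nth by (simp add: ac_simps)
    have "- Pi2 (i, j) \<alpha> \<mu> = (\<Sum>r\<in>UNIV. \<Sum>s\<in>UNIV. U i \<alpha> s * of_real (matrix_inv g $ s $ r) * - cnj (U j r \<mu>))"
      unfolding frame_prod_def dot2_def by (simp add: sum_negf)
    also have "\<dots> = (\<Sum>r\<in>UNIV. \<Sum>s\<in>UNIV. of_real (matrix_inv g $ r $ s) * U i \<alpha> s * cnj (U j \<mu> r))"
      by (intro sum.cong refl, subst U_antisym[of j], subst sym) simp
    finally show ?thesis by simp
  qed
  have "bel_robinson g \<eta> W \<alpha> \<mu> \<beta> \<nu> = (\<Sum>r\<in>UNIV. \<Sum>s\<in>UNIV. \<Sum>i\<in>UNIV. \<Sum>j\<in>UNIV. \<rho> i * cnj (\<rho> j) *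
      (raise2 g (\<lambda>r s. U i \<alpha> r * U i \<beta> s) r s * (cnj (U j \<mu> r) * cnj (U j \<nu> s))))"
  proof -
    have R: "raise2 g (\<lambda>r s. X \<alpha> r \<beta> s) r s = - (\<Sum>i\<in>UNIV. \<rho> i * raise2 g (\<lambda>r s. U i \<alpha> r * U i \<beta> s) r s)" for r s
      unfolding X_U raise2_minus raise2_sum raise2_mult ..
    have C: "cnj (X \<mu> r \<nu> s) = - (\<Sum>j\<in>UNIV. cnj (\<rho> j) * (cnj (U j \<mu> r) * cnj (U j \<nu> s)))" for r s
      by (simp add: X_U)
    show ?thesis
      unfolding bel_robinson_def R C minus_mult_minus sum_product
      by (intro sum.cong refl) (simp add: ac_simps)
  qed
  also have "\<dots> = (\<Sum>i\<in>UNIV. \<Sum>j\<in>UNIV. \<rho> i * cnj (\<rho> j) * (\<Sum>r\<in>UNIV. \<Sum>s\<in>UNIV.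
      (raise2 g (\<lambda>r s. U i \<alpha> r * U i \<beta> s) r s * (cnj (U j \<mu> r) * cnj (U j \<nu> s)))))"
    unfolding sum_distrib_left by (rule sum_swap4)
  finally show ?thesis
    unfolding sum_raise2_rank_one Pi2 by simp
qed

lemma tensor_act_Pi2:
  "tensor_act g (bel_robinson g \<eta> W) A
    = (\<Sum>p\<in>UNIV. scale2 ((\<rho> (fst p) * cnj (\<rho> (snd p))) * contract2 g (Pi2 p) A) (Pi2 p))"
proof (intro ext)
  fix \<alpha> \<beta>
  have "bel_robinson g \<eta> W \<alpha> \<beta> = (\<lambda>\<mu> \<nu>. \<Sum>p\<in>UNIV. scale2 (\<rho> (fst p) * cnj (\<rho> (snd p)) * Pi2 p \<alpha> \<beta>) (Pi2 p) \<mu> \<nu>)"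
    unfolding fun_eq_iff bel_robinson_Pi2 scale2_def sum.cartesian_product UNIV_Times_UNIV
    by (simp add: case_prod_beta mult.assoc)
  then show "tensor_act g (bel_robinson g \<eta> W) A \<alpha> \<beta>
    = (\<Sum>p\<in>UNIV. scale2 ((\<rho> (fst p) * cnj (\<rho> (snd p))) * contract2 g (Pi2 p) A) (Pi2 p)) \<alpha> \<beta>"
    unfolding tensor_act_contract2
    by (simp only: contract2_sum_left contract2_scale2_left sum_fun_apply) (simp add: scale2_def ac_simps)
qed

text \<open>\<open>sym_traceless_products\<close> gives products of arbitrary self-dual bivectors.
  Each factor expands in \<open>U\<close>, the second one with conjugated coefficients.\<close>

lemma sym_traceless_span_Pi2: "sym_traceless g \<subseteq> tensor2.span (range Pi2)"
proof
  fix A assume "A \<in> sym_traceless g"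
  from sym_traceless_products[OF this] obtain B :: "3 \<Rightarrow> complex tensor2" and c where B: "range B \<subseteq> SD g \<eta>" and
    A: "A = (\<lambda>\<alpha> \<beta>. \<Sum>i\<in>UNIV. \<Sum>j\<in>UNIV. c i j * dot2 g (B i) (\<lambda>\<alpha> \<beta>. cnj (B j \<alpha> \<beta>)) \<alpha> \<beta>)"
    by (elim exE conjE)
  have span: "dot2 g F (\<lambda>\<alpha> \<beta>. cnj (K \<alpha> \<beta>)) \<in> tensor2.span (range Pi2)" if FK: "F \<in> SD g \<eta>" "K \<in> SD g \<eta>" for F K
  proof -
    define f where "f i = - contract2 g (U i) F / 2" for i
    define k where "k i = - contract2 g (U i) K / 2" for i
    have f: "F \<alpha> \<beta> = (\<Sum>i\<in>UNIV. f i * U i \<alpha> \<beta>)" for \<alpha> \<beta>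
      unfolding f_def by (rule SD_expansion[OF FK(1)])
    have k: "K \<alpha> \<beta> = (\<Sum>i\<in>UNIV. k i * U i \<alpha> \<beta>)" for \<alpha> \<beta>
      unfolding k_def by (rule SD_expansion[OF FK(2)])
    have "dot2 g F (\<lambda>\<alpha> \<beta>. cnj (K \<alpha> \<beta>)) \<alpha> \<beta> = (\<Sum>i\<in>UNIV. \<Sum>j\<in>UNIV. f i * cnj (k j) * Pi2 (i, j) \<alpha> \<beta>)" for \<alpha> \<beta>
    proof -
      have "dot2 g F (\<lambda>\<alpha> \<beta>. cnj (K \<alpha> \<beta>)) \<alpha> \<beta> = (\<Sum>\<mu>\<in>UNIV. \<Sum>\<nu>\<in>UNIV. \<Sum>i\<in>UNIV. \<Sum>j\<in>UNIV.
          f i * cnj (k j) * (U i \<alpha> \<nu> * of_real (matrix_inv g $ \<nu> $ \<mu>) * cnj (U j \<mu> \<beta>)))"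
        unfolding dot2_def f k by (simp add: sum_product sum_distrib_right sum_distrib_left ac_simps)
      also have "\<dots> = (\<Sum>i\<in>UNIV. \<Sum>j\<in>UNIV. f i * cnj (k j) * Pi2 (i, j) \<alpha> \<beta>)"
        unfolding frame_prod_def dot2_def sum_distrib_left fst_conv snd_conv by (rule sum_swap4)
      finally show ?thesis .
    qed
    then have "dot2 g F (\<lambda>\<alpha> \<beta>. cnj (K \<alpha> \<beta>)) = (\<Sum>i\<in>UNIV. \<Sum>j\<in>UNIV. scale2 (f i * cnj (k j)) (Pi2 (i, j)))"
      by (intro ext) (simp add: sum_fun_apply scale2_def)
    then show ?thesis
      by (simp only:) (intro tensor2.span_sum tensor2.span_scale tensor2.span_base rangeI)
  qed
  have "A = (\<Sum>i\<in>UNIV. \<Sum>j\<in>UNIV. scale2 (c i j) (dot2 g (B i) (\<lambda>\<alpha> \<beta>. cnj (B j \<alpha> \<beta>))))"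
    unfolding A by (intro ext) (simp add: sum_fun_apply scale2_def)
  then show "A \<in> tensor2.span (range Pi2)"
    using B by (simp only:) (intro tensor2.span_sum tensor2.span_scale span; auto)
qed

lemma subspace_sym_traceless: "tensor2.subspace (sym_traceless g)"
  unfolding tensor2.subspace_def sym_traceless_def mem_Collect_eq scale2_def
proof (intro conjI ballI allI)
  fix c A \<alpha> \<beta>
  assume A: "A \<in> {A. (\<forall>\<alpha> \<beta>. A \<alpha> \<beta> = A \<beta> \<alpha>) \<and>
     (\<Sum>\<alpha>\<in>UNIV. \<Sum>\<beta>\<in>UNIV. complex_of_real (matrix_inv g $ \<alpha> $ \<beta>) * A \<alpha> \<beta>) = 0}"
  then have "A \<alpha> \<beta> = A \<beta> \<alpha>" by blast
  then show "c * A \<alpha> \<beta> = c * A \<beta> \<alpha>" by simp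
  have "(\<Sum>\<alpha>\<in>UNIV. \<Sum>\<beta>\<in>UNIV. complex_of_real (matrix_inv g $ \<alpha> $ \<beta>) * (c * A \<alpha> \<beta>))
    = c * (\<Sum>\<alpha>\<in>UNIV. \<Sum>\<beta>\<in>UNIV. complex_of_real (matrix_inv g $ \<alpha> $ \<beta>) * A \<alpha> \<beta>)"
    by (simp add: sum_distrib_left ac_simps)
  then show "(\<Sum>\<alpha>\<in>UNIV. \<Sum>\<beta>\<in>UNIV. complex_of_real (matrix_inv g $ \<alpha> $ \<beta>) * (c * A \<alpha> \<beta>)) = 0"
    using A by simp
next
  fix A B \<alpha> \<beta>
  assume A: "A \<in> {A. (\<forall>\<alpha> \<beta>. A \<alpha> \<beta> = A \<beta> \<alpha>) \<and>
     (\<Sum>\<alpha>\<in>UNIV. \<Sum>\<beta>\<in>UNIV. complex_of_real (matrix_inv g $ \<alpha> $ \<beta>) * A \<alpha> \<beta>) = 0}"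
    and B: "B \<in> {A. (\<forall>\<alpha> \<beta>. A \<alpha> \<beta> = A \<beta> \<alpha>) \<and>
     (\<Sum>\<alpha>\<in>UNIV. \<Sum>\<beta>\<in>UNIV. complex_of_real (matrix_inv g $ \<alpha> $ \<beta>) * A \<alpha> \<beta>) = 0}"
  then have "A \<alpha> \<beta> = A \<beta> \<alpha>" "B \<alpha> \<beta> = B \<beta> \<alpha>" by blast+
  then show "(A + B) \<alpha> \<beta> = (A + B) \<beta> \<alpha>" by simp
  show "(\<Sum>\<alpha>\<in>UNIV. \<Sum>\<beta>\<in>UNIV. complex_of_real (matrix_inv g $ \<alpha> $ \<beta>) * (A + B) \<alpha> \<beta>) = 0"
    using A B by (simp add: distrib_left sum.distrib)
qed simp_all

sublocale diagonal_map "sym_traceless g" "tensor_act g (bel_robinson g \<eta> W)" Pi2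
  "\<lambda>p. contract2 g (Pi2 p)" "\<lambda>p. \<rho> (fst p) * cnj (\<rho> (snd p))"
proof
  fix A assume "A \<in> sym_traceless g"
  then show "A = (\<Sum>p\<in>UNIV. scale2 (contract2 g (Pi2 p) A) (Pi2 p))"
    using span_orthogonal_expansion[of Pi2 1 A] contract2_Pi2 sym_traceless_span_Pi2 by (simp add: subset_iff)
qed (rule subspace_sym_traceless Pi2_sym_traceless contract2_add contract2_scale2 contract2_Pi2 tensor_act_Pi2)+

end

section \<open>Reality of the products of Weyl eigenvalues\<close>

lemma (in weyl_frame) real_eigenvalue_ratios:
  assumes "type_IMplus g \<eta> W"
  obtains c :: real and r :: "3 \<Rightarrow> real" where "c > 0" "\<And>i j. \<rho> i * cnj (\<rho> j) = complex_of_real (c * (r i * r j))"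
    "(\<Sum>i\<in>UNIV. r i) = 0" "\<And>i. r i \<noteq> 0" "inj r"
proof -
  define a b where "a = weyl_a g \<eta> W" and "b = weyl_b g \<eta> W"
  obtain m :: real where m: "m > 0" "a ^ 3 / b ^ 2 - 6 = m" and b: "b \<noteq> 0"
    using assms unfolding type_IMplus_def weyl_M_def a_def b_def by blast
  have ab: "a ^ 3 / b ^ 2 = complex_of_real (m + 6)"
    using m(2) by (simp add: algebra_simps)
  \<comment> \<open>The quotient a^3 / b^2 exceeds 6, so \<open>a\<close> cannot vanish and b / a
    may be formed below.\<close>
  have a: "a \<noteq> 0"
  proof
    assume "a = 0"
    then have "complex_of_real (m + 6) = 0"
      using ab by simp
    then show False
      using m(1) by (simp only: of_real_eq_0_iff)
  qed
  \<comment> \<open>The factor a / b makes the second and third power sums equal, both to the real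
    number a^3 / b^2.\<close>
  define y where "y i = \<rho> i * (a / b)" for i
  have \<rho>: "\<rho> i = (b / a) * y i" for i
    unfolding y_def using a b by simp
  have s: "y 1 + y 2 + y 3 = 0"
    using sum_eigenvalues(1) unfolding y_def sum_3 distrib_right[symmetric] by simp
  have "y 1 ^ 2 + y 2 ^ 2 + y 3 ^ 2 = a * (a / b) ^ 2"
    unfolding y_def a_def sum_eigenvalues(2) sum_3 power_mult_distrib by (simp only: distrib_right)
  also have "\<dots> = a ^ 3 / b ^ 2"
    by (simp add: power2_eq_square power3_eq_cube)
  finally have s2: "y 1 ^ 2 + y 2 ^ 2 + y 3 ^ 2 = complex_of_real (m + 6)"
    unfolding ab .
  have "y 1 ^ 3 + y 2 ^ 3 + y 3 ^ 3 = b * (a / b) ^ 3"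
    unfolding y_def b_def sum_eigenvalues(3) sum_3 power_mult_distrib by (simp only: distrib_right)
  also have "\<dots> = a ^ 3 / b ^ 2"
    using b by (simp add: power2_eq_square power3_eq_cube)
  finally have s3: "y 1 ^ 3 + y 2 ^ 3 + y 3 ^ 3 = complex_of_real (m + 6)"
    unfolding ab .
  have m6: "m + 6 > 6" using m(1) by simp
  note c1 = cubic_root_real[OF s s2 s3 m6]
  \<comment> \<open>\<open>cubic_root_real\<close> concerns its first root; cyclic shifts supply the
    other two.\<close>
  note c2 = cubic_root_real[of "y 2" "y 3" "y 1" "m + 6"]
  note c3 = cubic_root_real[of "y 3" "y 1" "y 2" "m + 6"]
  have real: "y 1 \<in> \<real>" "y 2 \<in> \<real>" "y 3 \<in> \<real>" and ne: "y 1 \<noteq> 0" "y 2 \<noteq> 0" "y 3 \<noteq> 0"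
    and dist: "y 1 \<noteq> y 2" "y 2 \<noteq> y 3" "y 3 \<noteq> y 1"
    using c1 c2 c3 s s2 s3 m6 by (simp_all add: ac_simps)
  define r where "r i = Re (y i)" for i
  have "\<forall>i. y i \<in> \<real>"
    unfolding forall_3 using real by blast
  then have yr: "y i = complex_of_real (r i)" for i
    unfolding r_def by (simp add: of_real_Re)
  show thesis
  proof
    \<comment> \<open>Each \<rho>_i is b / a times a real number, so the phase of b / a cancels
      between \<rho>_i and the conjugate of \<rho>_j, leaving the squared modulus.\<close>
    show "(cmod (b / a))^2 > 0" using a b by simp
    show "\<rho> i * cnj (\<rho> j) = complex_of_real ((cmod (b / a))^2 * (r i * r j))" for i j
      unfolding \<rho> yr of_real_mult complex_norm_square by (simp add: ac_simps)
    show "(\<Sum>i\<in>UNIV. r i) = 0"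
      using s unfolding yr sum_3 by (metis of_real_add of_real_eq_0_iff)
    have "\<forall>i. r i \<noteq> 0"
      unfolding forall_3 using ne unfolding yr by simp
    then show "r i \<noteq> 0" for i by blast
    have "\<forall>i j. r i = r j \<longrightarrow> i = j"
      unfolding forall_3 using dist dist[symmetric] unfolding yr by simp
    then show "inj r" by (simp add: inj_def)
  qed
qed

section \<open>Canonical form, multiplicities and eigenspaces\<close>

theorem proposition5:
  fixes g :: metric and \<eta> W :: "real tensor4"
    and \<rho> :: "3 \<Rightarrow> complex" and U :: "3 \<Rightarrow> complex tensor2"
  assumes "lorentzian g" and "volume_element g \<eta>"
    and "weyl_tensor g W" and "type_IMplus g \<eta> W"
    and "SD_orthonormal_frame g \<eta> U"
    and "\<And>i. biv_act g (sd_weyl g \<eta> W) (U i) = scale2 (\<rho> i) (U i)"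
  shows "(\<forall>\<alpha> \<beta> \<mu> \<nu>. sd_weyl g \<eta> W \<alpha> \<beta> \<mu> \<nu> = - (\<Sum>i\<in>UNIV. \<rho> i * otimes2 (U i) (U i) \<alpha> \<beta> \<mu> \<nu>)) \<and>
    (\<forall>\<alpha> \<beta> \<mu> \<nu>. bel_robinson g \<eta> W \<alpha> \<beta> \<mu> \<nu> =
       (\<Sum>i\<in>UNIV. br_t \<rho> i * otimes2 (frame_prod g U i i) (frame_prod g U i i) \<alpha> \<beta> \<mu> \<nu>) +
       (\<Sum>i\<in>UNIV. br_tau \<rho> i *
          (otimes2 (frame_prod g U (i+1) (i+2)) (frame_prod g U (i+1) (i+2)) \<alpha> \<beta> \<mu> \<nu> +
           otimes2 (frame_prod g U (i+2) (i+1)) (frame_prod g U (i+2) (i+1)) \<alpha> \<beta> \<mu> \<nu>))) \<and>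
    (\<forall>i. eigen_mult g (bel_robinson g \<eta> W) (br_t \<rho> i) = 1 \<and>
         eigenspace g (bel_robinson g \<eta> W) (br_t \<rho> i) = tensor2.span {frame_prod g U i i}) \<and>
    (\<forall>i. br_tau \<rho> i \<in> \<real> \<and>
         eigen_mult g (bel_robinson g \<eta> W) (br_tau \<rho> i) = 2 \<and>
         tensor2.dim (br_plane g U i) = 2 \<and>
         eigenspace g (bel_robinson g \<eta> W) (br_tau \<rho> i) = br_plane g U i)"
proof -
  \<comment> \<open>\<open>U 1\<close> has norm -1, so it is the nonzero self-dual witness that
    yields a tetrad.\<close>
  have "biv_metric g (U 1) (U 1) = -1"
    using assms(5) unfolding SD_orthonormal_frame_def by simp
  then have "U 1 \<noteq> 0"
    by (auto simp: biv_metric_def)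
  moreover have "U 1 \<in> SD g \<eta>"
    using assms(5) tensor2.span_base[of "U 1" "range U"] unfolding SD_orthonormal_frame_def by auto
  ultimately obtain P Q e where "weyl_tetrad g P Q \<eta> W e"
    using weyl_tetrad_exists assms(1-3) by metis
  then interpret weyl_frame g P Q \<eta> W e U \<rho>
    using assms(5,6) by (simp add: weyl_frame_def weyl_frame_axioms_def)
  obtain c :: real and r where c: "c > 0" and prods: "\<And>i j. \<rho> i * cnj (\<rho> j) = complex_of_real (c * (r i * r j))"
    and r: "(\<Sum>i\<in>UNIV. r i) = 0" "\<And>i. r i \<noteq> 0" "inj r"
    using real_eigenvalue_ratios[OF assms(4)] by metis
  have t: "br_t \<rho> i = complex_of_real (c * (r i * r i))" for i
    unfolding br_t_def complex_norm_square prods ..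
  have tau: "br_tau \<rho> i = complex_of_real (c * (r (i + 1) * r (i + 2)))" for i
    unfolding br_tau_def prods ..
  \<comment> \<open>Multiplicities and eigenspaces are read off from the index pairs attaining a
    value; after cancelling c > 0 these are given by \<open>zero_sum_products\<close>.\<close>
  have t_indices: "{p. \<rho> (fst p) * cnj (\<rho> (snd p)) = br_t \<rho> i} = {(i, i)}" for i
    unfolding prods t of_real_eq_iff using c zero_sum_products(1)[OF r] by auto
  have tau_indices: "{p. \<rho> (fst p) * cnj (\<rho> (snd p)) = br_tau \<rho> i} = {(i + 1, i + 2), (i + 2, i + 1)}" for i
    unfolding prods tau of_real_eq_iff using c zero_sum_products(2)[OF r] by auto
  have plane: "br_plane g U i = tensor2.span (Pi2 ` {(i + 1, i + 2), (i + 2, i + 1)})" for i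
    unfolding br_plane_def by simp
  have card: "card {(i + 1, i + 2), (i + 2, i + 1)} = 2" for i :: 3
    by simp
  have mult: "eigen_mult g (bel_robinson g \<eta> W) l = card {p. \<rho> (fst p) * cnj (\<rho> (snd p)) = l}" for l
    unfolding eigen_mult_def generalized_eigenspace dim_span_v ..
  have eig: "eigenspace g (bel_robinson g \<eta> W) l = tensor2.span (Pi2 ` {p. \<rho> (fst p) * cnj (\<rho> (snd p)) = l})" for l
    unfolding eigenspace_def by (rule eigenspace_span)
  have num: "(4::3) = 1" "(5::3) = 2" by simp_all
  \<comment> \<open>In the sum of nine terms \<Pi>_kj carries the conjugate of \<tau>_i. By
    \<open>prods\<close> all coefficients are real, so \<Pi>_jk and \<Pi>_kj share the coefficient
    \<tau>_i.\<close>
  have canonical: "bel_robinson g \<eta> W \<alpha> \<beta> \<mu> \<nu> =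
       (\<Sum>i\<in>UNIV. br_t \<rho> i * otimes2 (frame_prod g U i i) (frame_prod g U i i) \<alpha> \<beta> \<mu> \<nu>) +
       (\<Sum>i\<in>UNIV. br_tau \<rho> i *
          (otimes2 (frame_prod g U (i+1) (i+2)) (frame_prod g U (i+1) (i+2)) \<alpha> \<beta> \<mu> \<nu> +
           otimes2 (frame_prod g U (i+2) (i+1)) (frame_prod g U (i+2) (i+1)) \<alpha> \<beta> \<mu> \<nu>))" for \<alpha> \<beta> \<mu> \<nu>
    unfolding bel_robinson_Pi2 otimes2_def prods t tau sum_3 by (simp add: num algebra_simps)
  have weyl: "sd_weyl g \<eta> W \<alpha> \<beta> \<mu> \<nu> = - (\<Sum>i\<in>UNIV. \<rho> i * otimes2 (U i) (U i) \<alpha> \<beta> \<mu> \<nu>)" for \<alpha> \<beta> \<mu> \<nu>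
    unfolding otimes2_def by (rule X_U)
  have tau_real: "br_tau \<rho> i \<in> \<real>" for i
    unfolding tau by (rule Reals_of_real)
  have simple: "eigen_mult g (bel_robinson g \<eta> W) (br_t \<rho> i) = 1"
      "eigenspace g (bel_robinson g \<eta> W) (br_t \<rho> i) = tensor2.span {frame_prod g U i i}" for i
    unfolding mult eig t_indices by simp_all
  have double: "eigen_mult g (bel_robinson g \<eta> W) (br_tau \<rho> i) = 2"
      "eigenspace g (bel_robinson g \<eta> W) (br_tau \<rho> i) = br_plane g U i" for i
    unfolding mult eig tau_indices plane card by (rule refl)+
  have dim_plane: "tensor2.dim (br_plane g U i) = 2" for i
    unfolding plane dim_span_v card ..
  show ?thesis
    by (intro conjI allI weyl canonical simple double tau_real dim_plane)
qed

end
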